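(* Let $(\kappa_n)$ be a graphical sequence of kernels on a generalized vertex space $\mathcal V$ with limit $\kappa$, and let $G_n=G^{\mathcal V}(n,\kappa_n)$. Let $Z_k$ be the number of vertices of $G_n$ with degree $k$, and let $\lambda(x)=\int_{\mathcal S}\kappa(x,y)\,d\mu(y)$. For any fixed $k\ge0$, $$\frac{Z_k}{n}\xrightarrow{p}\int_{\mathcal S}\frac{\lambda(x)^k}{k!}e^{-\lambda(x)}\,d\mu(x).$$ Equivalently, $Z_k/|V(G_n)|\xrightarrow{p}\mathbb P(\Xi=k)$, where $\Xi$ has the mixed Poisson distribution $\int_{\mathcal S}\mathrm{Po}(\lambda(x))\,d\mu(x)/\mu(\mathcal S)$.
   Context: Spaces. A generalized ground space is a pair $(\mathcal S,\mu)$, where $\mathcal S$ is a separable metric space and $\mu$ is a Borel measure on $\mathcal S$ with $0<\mu(\mathcal S)<\infty$. A $\mu$-continuity set is a Borel set $A\subseteq\mathcal S$ with $\mu(\partial A)=0$. A generalized vertex space is a triple $\mathcal V=(\mathcal S,\mu,(\mathbf x_n)_{n\in I})$, where $(\mathcal S,\mu)$ is a generalized ground space, $I\subset(0,\infty)$ is an unbounded index set, and for each $n\in I$, $\mathbf x_n=(x_1,\dots,x_{v_n})$ is a random sequence of points of $\mathcal S$ of random length $v_n\ge0$ (the $x_i$ depend on $n$), such that $\#\{i:x_i\in A\}/n\xrightarrow{p}\mu(A)$ as $n\to\infty$ in $I$ for every $\mu$-continuity set $A$. Kernels and graphs. A kernel on $\mathcal V$ is a symmetric non-negative Borel measurable function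 on $\mathcal S\times\mathcal S$. For a kernel $\kappa$ and $n\in I$, $G^{\mathcal V}(n,\kappa)$ is the random graph on $\{1,\dots,v_n\}$ in which, given $\mathbf x_n$, each possible edge $ij$, $i<j$, is present with probability $\min\{\kappa(x_i,x_j)/n,1\}$, independently of the others. $e(G)$ is the number of edges and $V(G)$ the vertex set of $G$. A sequence $(\kappa_n)_{n\in I}$ of kernels on $\mathcal V$ is graphical on $\mathcal V$ with limit $\kappa$ (a kernel) if: for a.e. $(y,z)\in\mathcal S^2$, $y_n\to y$ and $z_n\to z$ imply $\kappa_n(y_n,z_n)\to\kappa(y,z)$; $\kappa$ is continuous a.e. on $\mathcal S\times\mathcal S$; $\kappa\in L^1(\mathcal S\times\mathcal S,\mu\times\mu)$; and $\frac1n\mathbb E\,e(G^{\mathcal V}(n,\kappa_n))\to\frac12\iint_{\mathcal S^2}\kappa\,d\mu\,d\mu$. Limits are as $n\to\infty$ in $I$. *)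

theory Defs
  imports "HOL-Probability.Probability"
begin

definition at_top_in :: "real set \<Rightarrow> real filter" where
  "at_top_in I = inf at_top (principal I)"

definition tendsto_in_prob ::
    "('i \<Rightarrow> 'b measure) \<Rightarrow> ('i \<Rightarrow> 'b \<Rightarrow> real) \<Rightarrow> real \<Rightarrow> 'i filter \<Rightarrow> bool" where
  "tendsto_in_prob P Y c F \<longleftrightarrow>
     (\<forall>\<epsilon>>0. ((\<lambda>n. measure (P n) {\<omega> \<in> space (P n). \<bar>Y n \<omega> - c\<bar> > \<epsilon>}) \<longlongrightarrow> 0) F)"

text \<open>A random finite sequence of random length; the \<open>i\<close>-th entry need only be
  measurable on the event that it exists.\<close>

definition random_list :: "'w measure \<Rightarrow> ('w \<Rightarrow> 'a::topological_space list) \<Rightarrow> bool" where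
  "random_list P X \<longleftrightarrow>
     (\<lambda>\<omega>. length (X \<omega>)) \<in> measurable P (count_space UNIV) \<and>
     (\<forall>i. (\<lambda>\<omega>. X \<omega> ! i) \<in>
        borel_measurable (restrict_space P {\<omega> \<in> space P. i < length (X \<omega>)}))"

text \<open>The separable metric space is the whole type: for metric spaces, separability is the
  same as second countability.\<close>

locale generalized_ground_space = finite_measure \<mu>
  for \<mu> :: "'a::{metric_space, second_countable_topology} measure" +
  assumes sets_mu: "sets \<mu> = sets borel"
    and mu_pos: "emeasure \<mu> UNIV > 0"

definition continuity_set :: "'a::topological_space measure \<Rightarrow> 'a set \<Rightarrow> bool" where
  "continuity_set \<mu> A \<longleftrightarrow> A \<in> sets borel \<and> emeasure \<mu> (frontier A) = 0"

text \<open>The random sequence \<open>X n\<close> lives on its own probability space \<open>P n\<close>. What happens for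
  indices \<open>n\<close> outside \<open>I\<close> is irrelevant throughout.\<close>

locale generalized_vertex_space = generalized_ground_space \<mu>
  for \<mu> :: "'a::{metric_space, second_countable_topology} measure"
    and I :: "real set"
    and P :: "real \<Rightarrow> 'w measure"
    and X :: "real \<Rightarrow> 'w \<Rightarrow> 'a list" +
  assumes index_pos: "I \<subseteq> {0<..}"
    and index_unbounded: "\<not> bdd_above I"
    and prob_space_P: "n \<in> I \<Longrightarrow> prob_space (P n)"
    and random_list_X: "n \<in> I \<Longrightarrow> random_list (P n) (X n)"
    and vertices_tendsto: "continuity_set \<mu> A \<Longrightarrow>
      tendsto_in_prob P
        (\<lambda>n \<omega>. real (card {i. i < length (X n \<omega>) \<and> X n \<omega> ! i \<in> A}) / n)
        (measure \<mu> A) (at_top_in I)"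

definition is_kernel :: "('a::topological_space \<Rightarrow> 'a \<Rightarrow> real) \<Rightarrow> bool" where
  "is_kernel \<kappa> \<longleftrightarrow>
     (\<forall>x y. \<kappa> x y = \<kappa> y x) \<and> (\<forall>x y. 0 \<le> \<kappa> x y) \<and> case_prod \<kappa> \<in> borel_measurable borel"

text \<open>A graph is a pair of a vertex set and a set of two-element edges. Lists being indexed
  from \<open>0\<close>, the vertex set of a graph built from \<open>v\<close> points is \<open>{..<v}\<close> rather than \<open>{1..v}\<close>.\<close>

type_synonym graph = "nat set \<times> nat set set"

definition verts :: "graph \<Rightarrow> nat set" where
  "verts g = fst g"

definition edges :: "graph \<Rightarrow> nat set set" where
  "edges g = snd g"

definition vertex_degree :: "graph \<Rightarrow> nat \<Rightarrow> nat" where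
  "vertex_degree g i = card {e \<in> edges g. i \<in> e}"

definition num_degree :: "nat \<Rightarrow> graph \<Rightarrow> nat" where
  "num_degree k g = card {i \<in> verts g. vertex_degree g i = k}"

definition vertex_pairs :: "nat \<Rightarrow> (nat \<times> nat) set" where
  "vertex_pairs v = {(i, j). i < j \<and> j < v}"

definition graph_of_indicator :: "nat \<Rightarrow> (nat \<times> nat \<Rightarrow> bool) \<Rightarrow> graph" where
  "graph_of_indicator v b = ({..<v}, {{i, j} | i j. (i, j) \<in> vertex_pairs v \<and> b (i, j)})"

text \<open>The conditional law of the random graph given the sequence of points \<open>xs\<close>.\<close>

definition graph_given :: "real \<Rightarrow> ('a \<Rightarrow> 'a \<Rightarrow> real) \<Rightarrow> 'a list \<Rightarrow> graph pmf" where
  "graph_given n \<kappa> xs =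
     map_pmf (graph_of_indicator (length xs))
       (Pi_pmf (vertex_pairs (length xs)) False
         (\<lambda>(i, j). bernoulli_pmf (min (\<kappa> (xs ! i) (xs ! j) / n) 1)))"

text \<open>The law of the random graph, i.e. the mixture of its conditional laws over the random
  sequence of points. That this is a probability measure on the discrete space of all graphs is
  shown in \<open>prob_space_random_graph\<close> below.\<close>

definition random_graph ::
    "(real \<Rightarrow> 'w measure) \<Rightarrow> (real \<Rightarrow> 'w \<Rightarrow> 'a list) \<Rightarrow> real \<Rightarrow> ('a \<Rightarrow> 'a \<Rightarrow> real) \<Rightarrow> graph measure"
  where
  "random_graph P X n \<kappa> = P n \<bind> (\<lambda>\<omega>. measure_pmf (graph_given n \<kappa> (X n \<omega>)))"

text \<open>The expected number of edges may be infinite, hence is an extended nonnegative real.\<close>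

definition graphical ::
    "'a::{metric_space, second_countable_topology} measure \<Rightarrow> real set \<Rightarrow> (real \<Rightarrow> 'w measure) \<Rightarrow>
     (real \<Rightarrow> 'w \<Rightarrow> 'a list) \<Rightarrow> (real \<Rightarrow> 'a \<Rightarrow> 'a \<Rightarrow> real) \<Rightarrow> ('a \<Rightarrow> 'a \<Rightarrow> real) \<Rightarrow> bool" where
  "graphical \<mu> I P X \<kappa>s \<kappa> \<longleftrightarrow>
     (\<forall>n\<in>I. is_kernel (\<kappa>s n)) \<and> is_kernel \<kappa> \<and>
     (AE (y, z) in \<mu> \<Otimes>\<^sub>M \<mu>. \<forall>ys zs.
        (ys \<longlongrightarrow> y) (at_top_in I) \<longrightarrow> (zs \<longlongrightarrow> z) (at_top_in I) \<longrightarrow>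
        ((\<lambda>n. \<kappa>s n (ys n) (zs n)) \<longlongrightarrow> \<kappa> y z) (at_top_in I)) \<and>
     (AE p in \<mu> \<Otimes>\<^sub>M \<mu>. isCont (case_prod \<kappa>) p) \<and>
     integrable (\<mu> \<Otimes>\<^sub>M \<mu>) (case_prod \<kappa>) \<and>
     ((\<lambda>n. (\<integral>\<^sup>+ g. of_nat (card (edges g)) \<partial>random_graph P X n (\<kappa>s n)) / ennreal n) \<longlongrightarrow>
        ennreal (1 / 2 * (\<integral>p. case_prod \<kappa> p \<partial>(\<mu> \<Otimes>\<^sub>M \<mu>)))) (at_top_in I)"

text \<open>For an integrable kernel the integral is finite for almost every \<open>x\<close>; elsewhere the
  Bochner integral is \<open>0\<close>, which does not affect integrals over \<open>x\<close>.\<close>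

definition kernel_lambda :: "'a measure \<Rightarrow> ('a \<Rightarrow> 'a \<Rightarrow> real) \<Rightarrow> 'a \<Rightarrow> real" where
  "kernel_lambda \<mu> \<kappa> x = (\<integral>y. \<kappa> x y \<partial>\<mu>)"

text \<open>The library specifies \<open>poisson_pmf\<close> only for positive rates.\<close>

definition Po :: "real \<Rightarrow> nat pmf" where
  "Po r = (if r = 0 then return_pmf 0 else poisson_pmf r)"

definition mixed_poisson :: "'a measure \<Rightarrow> ('a \<Rightarrow> real) \<Rightarrow> nat measure" where
  "mixed_poisson \<mu> r =
     scale_measure (1 / emeasure \<mu> (space \<mu>)) (\<mu> \<bind> (\<lambda>x. measure_pmf (Po (r x))))"

lemma finite_vertex_pairs: "finite (vertex_pairs v)"
  by (rule finite_subset[of _ "{..<v} \<times> {..<v}"]) (auto simp: vertex_pairs_def)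

lemma random_list_pair_measurable:
  fixes X :: "'w \<Rightarrow> 'a::{metric_space, second_countable_topology} list"
  assumes X: "random_list P X" and k: "is_kernel \<kappa>" and ij: "i < v" "j < v"
  shows "(\<lambda>\<omega>. \<kappa> (X \<omega> ! i) (X \<omega> ! j)) \<in>
    borel_measurable (restrict_space P {\<omega> \<in> space P. length (X \<omega>) = v})"
proof -
  let ?R = "restrict_space P {\<omega> \<in> space P. length (X \<omega>) = v}"
  have nth: "(\<lambda>\<omega>. X \<omega> ! l) \<in> borel_measurable ?R" if "l < v" for l
  proof -
    have "(\<lambda>\<omega>. X \<omega> ! l) \<in> borel_measurable (restrict_space P {\<omega> \<in> space P. l < length (X \<omega>)})"
      using X by (auto simp: random_list_def)
    from measurable_restrict_mono[OF this, of "{\<omega> \<in> space P. length (X \<omega>) = v}"] that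
    show ?thesis by auto
  qed
  have "(\<lambda>\<omega>. (X \<omega> ! i, X \<omega> ! j)) \<in> borel_measurable ?R"
    using nth[OF ij(1)] nth[OF ij(2)] by (rule borel_measurable_Pair)
  moreover have "case_prod \<kappa> \<in> borel_measurable borel"
    using k by (simp add: is_kernel_def)
  ultimately have "(\<lambda>\<omega>. case_prod \<kappa> (X \<omega> ! i, X \<omega> ! j)) \<in> borel_measurable ?R"
    by (rule measurable_compose)
  then show ?thesis by simp
qed

lemma graph_given_eq_sum:
  "measure (measure_pmf (graph_given n \<kappa> xs)) A =
    (\<Sum>b \<in> {b. (\<forall>e. e \<notin> vertex_pairs (length xs) \<longrightarrow> \<not> b e) \<and> graph_of_indicator (length xs) b \<in> A}.
      \<Prod>e \<in> vertex_pairs (length xs).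
        pmf (bernoulli_pmf (min (\<kappa> (xs ! fst e) (xs ! snd e) / n) 1)) (b e))"
proof -
  let ?E = "vertex_pairs (length xs)"
  let ?p = "\<lambda>(i, j). bernoulli_pmf (min (\<kappa> (xs ! i) (xs ! j) / n) 1)"
  let ?D = "{b. \<forall>e. e \<notin> ?E \<longrightarrow> \<not> b e}"
  let ?B = "{b. (\<forall>e. e \<notin> ?E \<longrightarrow> \<not> b e) \<and> graph_of_indicator (length xs) b \<in> A}"
  have fin: "finite ?D"
  proof (rule finite_subset)
    show "?D \<subseteq> (\<lambda>S e. e \<in> S) ` Pow ?E"
    proof
      fix b assume "b \<in> ?D"
      then show "b \<in> (\<lambda>S e. e \<in> S) ` Pow ?E"
        by (intro image_eqI[of _ _ "{e. b e}"]) auto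
    qed
  qed (simp add: finite_vertex_pairs)
  have supp: "set_pmf (Pi_pmf ?E False ?p) \<subseteq> ?D"
    using set_Pi_pmf_subset[OF finite_vertex_pairs, of "length xs" False ?p] by auto
  have "measure (measure_pmf (graph_given n \<kappa> xs)) A =
      measure (measure_pmf (Pi_pmf ?E False ?p)) (graph_of_indicator (length xs) -` A)"
    by (simp add: graph_given_def)
  also have "\<dots> = measure (measure_pmf (Pi_pmf ?E False ?p)) ?B"
    using supp by (intro measure_pmf.finite_measure_eq_AE) (auto simp: AE_measure_pmf_iff)
  also have "\<dots> = (\<Sum>b\<in>?B. pmf (Pi_pmf ?E False ?p) b)"
    by (intro measure_measure_pmf_finite finite_subset[OF _ fin]) auto
  also have "\<dots> = (\<Sum>b\<in>?B. \<Prod>e\<in>?E. pmf (?p e) (b e))"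
    by (intro sum.cong refl pmf_Pi') (auto simp: finite_vertex_pairs)
  finally show ?thesis by (simp add: case_prod_unfold)
qed

lemma graph_given_measurable:
  fixes X :: "'w \<Rightarrow> 'a::{metric_space, second_countable_topology} list"
  assumes X: "random_list P X" and k: "is_kernel \<kappa>" and n: "n > 0"
  shows "(\<lambda>\<omega>. measure_pmf (graph_given n \<kappa> (X \<omega>))) \<in> measurable P (subprob_algebra (count_space UNIV))"
proof (rule measurable_subprob_algebra)
  fix A :: "graph set"
  have len: "(\<lambda>\<omega>. length (X \<omega>)) \<in> measurable P (count_space UNIV)"
    using X by (simp add: random_list_def)
  let ?C = "range (\<lambda>v. {\<omega> \<in> space P. length (X \<omega>) = v})"
  have "(\<lambda>\<omega>. measure (measure_pmf (graph_given n \<kappa> (X \<omega>))) A) \<in> borel_measurable P"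
  proof (rule measurable_piecewise_restrict[of ?C])
    fix S assume "S \<in> ?C"
    then obtain v where S: "S = {\<omega> \<in> space P. length (X \<omega>) = v}" by blast
    have "S \<inter> space P = (\<lambda>\<omega>. length (X \<omega>)) -` {v} \<inter> space P" using S by auto
    then show "S \<inter> space P \<in> sets P"
      using measurable_sets[OF len, of "{v}"] by simp
    let ?R = "restrict_space P S"
    have m: "(\<lambda>\<omega>. \<kappa> (X \<omega> ! fst e) (X \<omega> ! snd e)) \<in> borel_measurable ?R"
      if "e \<in> vertex_pairs v" for e
      unfolding S using that
      by (intro random_list_pair_measurable[OF X k]) (auto simp: vertex_pairs_def)
    have p01: "0 \<le> min (\<kappa> x y / n) 1" "min (\<kappa> x y / n) 1 \<le> 1" for x y
      using k n by (auto simp: is_kernel_def)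
    have bern: "(\<lambda>\<omega>. pmf (bernoulli_pmf (min (\<kappa> (X \<omega> ! fst e) (X \<omega> ! snd e) / n) 1)) c)
        \<in> borel_measurable ?R" if e: "e \<in> vertex_pairs v" for e c
    proof -
      have "(\<lambda>\<omega>. min (\<kappa> (X \<omega> ! fst e) (X \<omega> ! snd e) / n) 1) \<in> borel_measurable ?R"
        using m[OF e] by (intro borel_measurable_min borel_measurable_divide) auto
      then show ?thesis
        by (cases c) (simp_all only: pmf_bernoulli_True pmf_bernoulli_False p01
          borel_measurable_diff borel_measurable_const)
    qed
    have "(\<lambda>\<omega>. \<Sum>b \<in> {b. (\<forall>e. e \<notin> vertex_pairs v \<longrightarrow> \<not> b e) \<and> graph_of_indicator v b \<in> A}.
        \<Prod>e \<in> vertex_pairs v.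
          pmf (bernoulli_pmf (min (\<kappa> (X \<omega> ! fst e) (X \<omega> ! snd e) / n) 1)) (b e))
        \<in> borel_measurable ?R"
      by (intro borel_measurable_sum borel_measurable_prod bern)
    then show "(\<lambda>\<omega>. measure (measure_pmf (graph_given n \<kappa> (X \<omega>))) A) \<in> borel_measurable ?R"
      by (rule measurable_cong[THEN iffD1, rotated])
        (auto simp: graph_given_eq_sum S space_restrict_space)
  qed auto
  then show "(\<lambda>\<omega>. emeasure (measure_pmf (graph_given n \<kappa> (X \<omega>))) A) \<in> borel_measurable P"
    by (simp add: measure_pmf.emeasure_eq_measure)
qed (auto simp: measure_pmf.subprob_space_axioms)

lemma prob_space_random_graph:
  fixes X :: "real \<Rightarrow> 'w \<Rightarrow> 'a::{metric_space, second_countable_topology} list"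
  assumes "prob_space (P n)" "random_list (P n) (X n)" "is_kernel \<kappa>" "n > 0"
  shows "prob_space (random_graph P X n \<kappa>)"
    and "sets (random_graph P X n \<kappa>) = UNIV"
    and "emeasure (random_graph P X n \<kappa>) A =
      (\<integral>\<^sup>+ \<omega>. emeasure (measure_pmf (graph_given n \<kappa> (X n \<omega>))) A \<partial>P n)"
proof -
  interpret prob_space "P n" by fact
  note m = graph_given_measurable[OF assms(2-4)]
  show "prob_space (random_graph P X n \<kappa>)"
    unfolding random_graph_def
    by (rule prob_space_bind[OF _ m]) (simp add: measure_pmf.prob_space_axioms)
  show "sets (random_graph P X n \<kappa>) = UNIV"
    unfolding random_graph_def using not_empty by (subst sets_bind) auto
  show "emeasure (random_graph P X n \<kappa>) A =
      (\<integral>\<^sup>+ \<omega>. emeasure (measure_pmf (graph_given n \<kappa> (X n \<omega>))) A \<partial>P n)"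
    unfolding random_graph_def by (rule emeasure_bind[OF not_empty m]) simp
qed

end

theory Submission
  imports Defs
begin

text \<open>Given the points, toggling one edge changes the number \<open>Z\<close> of vertices of degree \<open>k\<close> by at
  most 2, so by the Efron--Stein inequality the conditional variance of \<open>Z\<close> is at most four times
  the conditional expected number of edges. Hence \<open>Z / n\<close> is close to its conditional mean, which by
  Le Cam's inequality is close to the average over the vertices \<open>i\<close> of the Poisson weight at the
  conditional mean degree of \<open>i\<close>. This weight is a Lipschitz function of the mean degree.

  It remains to replace the edge probabilities by \<open>K(x, y) / n\<close>, where \<open>K\<close> is a step function on
  finitely many continuity sets with \<open>K \<le> \<kappa>s n\<close> for all large \<open>n\<close>, and \<open>\<integral>\<integral>K\<close> close to \<open>\<integral>\<integral>\<kappa>\<close>. Such a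
  \<open>K\<close> is found by taking infima of the kernels over cells and over all large indices. Since \<open>K\<close> is a
  minorant, the total \<open>L\<^sup>1\<close> error of the replacement is just the difference of the two sums,
  and its mean is small by the convergence of the expected number of edges. The same bound controls
  the sum of squared edge probabilities in Le Cam's inequality. For the step kernel everything is
  a continuous function of the finitely many proportions of points in the cells.\<close>

subsection \<open>Poisson weights\<close>

definition poisson_weight :: "nat \<Rightarrow> real \<Rightarrow> real" where
  "poisson_weight k t = t ^ k / fact k * exp (- t)"

lemma poisson_weight_zero: "poisson_weight k 0 = (if k = 0 then 1 else 0)"
  by (simp add: poisson_weight_def)

lemma poisson_weight_nonneg: "0 \<le> t \<Longrightarrow> 0 \<le> poisson_weight k t"
  by (simp add: poisson_weight_def)

text \<open>For \<open>t > 0\<close> the weight is a probability under the Poisson law. Rate 0 is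
  split off because \<open>poisson_pmf\<close> is only specified for positive rates.\<close>

lemma poisson_weight_le_1:
  assumes "0 \<le> t"
  shows "poisson_weight k t \<le> 1"
proof (cases "t = 0")
  case False
  then have "poisson_weight k t = pmf (poisson_pmf t) k"
    using assms by (simp add: poisson_weight_def)
  then show ?thesis by (simp add: pmf_le_1)
qed (simp add: poisson_weight_zero)

text \<open>Writing the derivative as a difference of two consecutive weights lets bounds and
  Lipschitz constants pass directly from the weights to their derivatives; the weight of index -1
  counts as 0.\<close>

definition poisson_weight_deriv :: "nat \<Rightarrow> real \<Rightarrow> real" where
  "poisson_weight_deriv k t =
     (case k of 0 \<Rightarrow> 0 | Suc j \<Rightarrow> poisson_weight j t) - poisson_weight k t"

lemma poisson_weight_has_derivative:
  "(poisson_weight k has_real_derivative poisson_weight_deriv k t) (at t within A)"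
proof (cases k)
  case 0
  have "((\<lambda>t. exp (- t)) has_real_derivative - exp (- t)) (at t within A)"
    by (auto intro!: derivative_eq_intros)
  then show ?thesis
    using 0 by (simp add: poisson_weight_def[abs_def] poisson_weight_deriv_def)
next
  case (Suc j)
  have "((\<lambda>t. t ^ Suc j / fact (Suc j) * exp (- t)) has_real_derivative
      (real (Suc j) * t ^ j / fact (Suc j) * exp (- t) - t ^ Suc j / fact (Suc j) * exp (- t)))
      (at t within A)"
    by (rule derivative_eq_intros refl | simp)+
  moreover have "real (Suc j) * t ^ j / fact (Suc j) = t ^ j / fact j"
    by (simp add: divide_simps del: of_nat_Suc)
  ultimately show ?thesis
    using Suc by (simp add: poisson_weight_def[abs_def] poisson_weight_deriv_def)
qed

lemma abs_poisson_weight_deriv_le: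
  assumes "0 \<le> t"
  shows "\<bar>poisson_weight_deriv k t\<bar> \<le> 1"
  using poisson_weight_nonneg[OF assms, of k] poisson_weight_le_1[OF assms, of k]
    poisson_weight_nonneg[OF assms, of "k - 1"] poisson_weight_le_1[OF assms, of "k - 1"]
  by (auto simp: poisson_weight_deriv_def split: nat.split)

lemma poisson_weight_lipschitz:
  assumes "0 \<le> s" "0 \<le> t"
  shows "\<bar>poisson_weight k s - poisson_weight k t\<bar> \<le> \<bar>s - t\<bar>"
proof -
  have "norm (poisson_weight k s - poisson_weight k t) \<le> 1 * norm (s - t)"
    using assms
    by (intro field_differentiable_bound[of "{0..}" "poisson_weight k" "poisson_weight_deriv k"]
        poisson_weight_has_derivative) (auto simp: abs_poisson_weight_deriv_le)
  then show ?thesis by simp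
qed

lemma poisson_weight_deriv_lipschitz:
  assumes "0 \<le> s" "0 \<le> t"
  shows "\<bar>poisson_weight_deriv k s - poisson_weight_deriv k t\<bar> \<le> 2 * \<bar>s - t\<bar>"
  using poisson_weight_lipschitz[OF assms, of k] poisson_weight_lipschitz[OF assms, of "k - 1"]
  by (cases k) (auto simp: poisson_weight_deriv_def abs_le_iff)

text \<open>The mean value theorem replaces the derivative at \<open>t\<close> by one at a point of
  distance at most \<open>p\<close>, and the constant 2 is the Lipschitz constant of the derivative.
  In Le Cam's inequality \<open>p\<close> is the success probability of one added variable.\<close>

lemma poisson_weight_step:
  assumes "0 \<le> t" "0 \<le> p"
  shows "\<bar>poisson_weight k (t + p) - poisson_weight k t - p * poisson_weight_deriv k t\<bar> \<le> 2 * p\<^sup>2"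
proof (cases "p = 0")
  case False
  then have "t < t + p" using assms by simp
  from MVT2[OF this, of "poisson_weight k" "poisson_weight_deriv k"]
  obtain z where z: "t < z" "z < t + p"
    "poisson_weight k (t + p) - poisson_weight k t = p * poisson_weight_deriv k z"
    using poisson_weight_has_derivative by auto
  have "\<bar>p * (poisson_weight_deriv k z - poisson_weight_deriv k t)\<bar> \<le> p * (2 * p)"
    unfolding abs_mult using z assms poisson_weight_deriv_lipschitz[of z t k]
    by (intro mult_mono) auto
  then show ?thesis using z(3) by (simp add: algebra_simps power2_eq_square)
qed simp

subsection \<open>Independent Bernoulli variables\<close>

abbreviation bern_field :: "'e set \<Rightarrow> ('e \<Rightarrow> real) \<Rightarrow> ('e \<Rightarrow> bool) pmf" where
  "bern_field E p \<equiv> Pi_pmf E False (\<lambda>e. bernoulli_pmf (p e))"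

lemma finite_set_bern_field: "finite E \<Longrightarrow> finite (set_pmf (bern_field E p))"
  by (simp add: set_Pi_pmf finite_PiE_dflt)

lemma integrable_bern_field [simp]:
  fixes f :: "('e \<Rightarrow> bool) \<Rightarrow> real"
  shows "finite E \<Longrightarrow> integrable (measure_pmf (bern_field E p)) f"
  by (rule integrable_measure_pmf_finite) (rule finite_set_bern_field)

text \<open>Conditioning on the single coordinate \<open>e\<close>. Both inductions over the index
  set, for Le Cam's inequality and for the variance bound, rest on this recursion.\<close>

lemma expectation_bern_field_insert:
  fixes f :: "('e \<Rightarrow> bool) \<Rightarrow> real"
  assumes "finite E" "e \<notin> E" "0 \<le> p e" "p e \<le> 1"
  shows "measure_pmf.expectation (bern_field (insert e E) p) f =
    p e * measure_pmf.expectation (bern_field E p) (\<lambda>b. f (b(e := True))) +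
    (1 - p e) * measure_pmf.expectation (bern_field E p) (\<lambda>b. f (b(e := False)))"
proof -
  have "bern_field (insert e E) p =
      bernoulli_pmf (p e) \<bind> (\<lambda>c. map_pmf (\<lambda>b. b(e := c)) (bern_field E p))"
    using assms by (simp add: Pi_pmf_insert' map_pmf_def)
  then have "measure_pmf.expectation (bern_field (insert e E) p) f =
      measure_pmf.expectation (bernoulli_pmf (p e) \<bind>
        (\<lambda>c. map_pmf (\<lambda>b. b(e := c)) (bern_field E p))) f"
    by simp
  also have "\<dots> = (\<Sum>c\<in>UNIV. pmf (bernoulli_pmf (p e)) c *
      measure_pmf.expectation (map_pmf (\<lambda>b. b(e := c)) (bern_field E p)) f)"
    using assms(1) by (subst pmf_expectation_bind[of UNIV]) (auto simp: finite_set_bern_field)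
  also have "\<dots> = (\<Sum>c\<in>UNIV. pmf (bernoulli_pmf (p e)) c *
      measure_pmf.expectation (bern_field E p) (\<lambda>b. f (b(e := c))))"
    by simp
  finally show ?thesis
    using assms by (simp add: UNIV_bool)
qed

lemma prob_bern_field_insert:
  assumes "finite E" "e \<notin> E" "0 \<le> p e" "p e \<le> 1"
  shows "measure (bern_field (insert e E) p) A =
    p e * measure (bern_field E p) {b. b(e := True) \<in> A} +
    (1 - p e) * measure (bern_field E p) {b. b(e := False) \<in> A}"
proof -
  have "measure_pmf.expectation q (\<lambda>b. indicator A (g b)) = measure (measure_pmf q) {b. g b \<in> A}"
    for q :: "('a \<Rightarrow> bool) pmf" and g
  proof -
    have "measure_pmf.expectation q (\<lambda>b. indicator A (g b) :: real) =
        measure_pmf.expectation q (indicator {b. g b \<in> A})"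
      by (intro Bochner_Integration.integral_cong) (auto simp: indicator_def)
    then show ?thesis by simp
  qed
  from this[of _ "\<lambda>b. b"] this[of _ "\<lambda>b. b(e := True)"] this[of _ "\<lambda>b. b(e := False)"]
  show ?thesis
    using expectation_bern_field_insert[where p = p, OF assms, of "indicator A"] by simp
qed

text \<open>Le Cam's inequality, by induction on \<open>E\<close>. Adding \<open>e\<close> averages
  the old errors at \<open>k - 1\<close> and \<open>k\<close> with weights \<open>p e\<close> and
  \<open>1 - p e\<close>, so they do not grow, and the Poisson weights obey the same recursion up to
  an error \<open>2 * (p e)\<^sup>2\<close>.\<close>

lemma bern_field_poisson_approximation:
  assumes "finite E" "\<And>e. e \<in> E \<Longrightarrow> 0 \<le> p e" "\<And>e. e \<in> E \<Longrightarrow> p e \<le> 1"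
  shows "\<bar>measure (bern_field E p) {b. card {e \<in> E. b e} = k} - poisson_weight k (sum p E)\<bar>
    \<le> 2 * (\<Sum>e\<in>E. (p e)\<^sup>2)"
  using assms
proof (induction E arbitrary: k rule: finite_induct)
  case empty
  then show ?case by (simp add: poisson_weight_zero)
next
  case (insert e E)
  have pe: "0 \<le> p e" "p e \<le> 1" using insert.prems by auto
  define m where "m j = measure (bern_field E p) {b. card {e' \<in> E. b e'} = j}" for j
  define t where "t = sum p E"
  define R where "R = 2 * (\<Sum>e\<in>E. (p e)\<^sup>2)"
  have t: "0 \<le> t" unfolding t_def using insert.prems by (intro sum_nonneg) auto
  have IH: "\<bar>m j - poisson_weight j t\<bar> \<le> R" for j
    unfolding m_def t_def R_def using insert by auto
  have R: "0 \<le> R" unfolding R_def by (intro mult_nonneg_nonneg sum_nonneg) auto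
  have T: "{e' \<in> insert e E. (b(e := True)) e'} = insert e {e' \<in> E. b e'}"
    and F: "{e' \<in> insert e E. (b(e := False)) e'} = {e' \<in> E. b e'}" for b
    using insert.hyps by auto
  have cT: "card {e' \<in> insert e E. (b(e := True)) e'} = Suc (card {e' \<in> E. b e'})" for b
    unfolding T using insert.hyps by simp
  have split: "measure (bern_field (insert e E) p) {b. card {e' \<in> insert e E. b e'} = k} =
      p e * (case k of 0 \<Rightarrow> 0 | Suc j \<Rightarrow> m j) + (1 - p e) * m k"
    unfolding prob_bern_field_insert[where p = p, OF insert.hyps pe] mem_Collect_eq cT F
    by (simp add: m_def split: nat.split)
  have "\<bar>(case k of 0 \<Rightarrow> 0 | Suc j \<Rightarrow> m j) - (case k of 0 \<Rightarrow> 0 | Suc j \<Rightarrow> poisson_weight j t)\<bar> \<le> R"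
    using IH R by (auto split: nat.split)
  then have "p e * \<bar>(case k of 0 \<Rightarrow> 0 | Suc j \<Rightarrow> m j) -
      (case k of 0 \<Rightarrow> 0 | Suc j \<Rightarrow> poisson_weight j t)\<bar> \<le> p e * R"
    using pe by (intro mult_left_mono)
  then have a: "\<bar>p e * (case k of 0 \<Rightarrow> 0 | Suc j \<Rightarrow> m j) -
      p e * (case k of 0 \<Rightarrow> 0 | Suc j \<Rightarrow> poisson_weight j t)\<bar> \<le> p e * R"
    using pe by (simp add: abs_mult flip: right_diff_distrib)
  have "(1 - p e) * \<bar>m k - poisson_weight k t\<bar> \<le> (1 - p e) * R"
    using pe IH by (intro mult_left_mono) auto
  then have b: "\<bar>(1 - p e) * m k - (1 - p e) * poisson_weight k t\<bar> \<le> (1 - p e) * R"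
    using pe by (simp add: abs_mult flip: right_diff_distrib)
  have "\<bar>poisson_weight k (t + p e) - poisson_weight k t - p e * poisson_weight_deriv k t\<bar> \<le> 2 * (p e)\<^sup>2"
    by (rule poisson_weight_step) (use t pe in auto)
  \<comment> \<open>The first-order expansion of the weight in \<open>p e\<close> is exactly the
    two-point mixture that occurs in the recursion for the Bernoulli field.\<close>
  then have c: "\<bar>poisson_weight k (t + p e) - (1 - p e) * poisson_weight k t -
      p e * (case k of 0 \<Rightarrow> 0 | Suc j \<Rightarrow> poisson_weight j t)\<bar> \<le> 2 * (p e)\<^sup>2"
    by (simp add: poisson_weight_deriv_def algebra_simps)
  have sp: "sum p (insert e E) = t + p e"
    using insert.hyps by (simp add: t_def)
  have d: "2 * (\<Sum>e\<in>insert e E. (p e)\<^sup>2) = R + 2 * (p e)\<^sup>2"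
    using insert.hyps by (simp add: R_def)
  have "p e * R + (1 - p e) * R = R" by (simp add: algebra_simps)
  then show ?case
    unfolding split sp d using a b c by linarith
qed

text \<open>The marginal of the field on \<open>S\<close> is again a Bernoulli field. It is applied
  with \<open>S\<close> the set of possible edges at one vertex.\<close>

lemma bern_field_subset_poisson_approximation:
  assumes "finite E" "S \<subseteq> E" "\<And>e. e \<in> E \<Longrightarrow> 0 \<le> p e" "\<And>e. e \<in> E \<Longrightarrow> p e \<le> 1"
  shows "\<bar>measure (bern_field E p) {b. card {e \<in> S. b e} = k} - poisson_weight k (sum p S)\<bar>
    \<le> 2 * (\<Sum>e\<in>S. (p e)\<^sup>2)"
proof -
  have "measure (bern_field S p) {b. card {e \<in> S. b e} = k} =
      measure (bern_field E p) {b. card {e \<in> S. b e} = k}"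
    unfolding Pi_pmf_subset[OF assms(1,2)]
    by (auto simp: vimage_def intro!: arg_cong[where f = "measure _"] arg_cong[where f = card])
  then show ?thesis
    using bern_field_poisson_approximation[of S p k] assms by (auto dest: finite_subset)
qed

lemma nn_integral_card_bern_field:
  assumes "finite E" "\<And>e. e \<in> E \<Longrightarrow> 0 \<le> p e" "\<And>e. e \<in> E \<Longrightarrow> p e \<le> 1"
  shows "(\<integral>\<^sup>+ b. of_nat (card {e \<in> E. b e}) \<partial>bern_field E p) = ennreal (sum p E)"
proof -
  have "of_nat (card {e \<in> E. b e}) = (\<Sum>e\<in>E. indicator {b. b e} b :: ennreal)" for b
  proof -
    have "card {e \<in> E. b e} = (\<Sum>e\<in>E. if b e then 1 else 0)"
      using assms(1) by (simp add: sum.If_cases Int_def)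
    also have "of_nat \<dots> = (\<Sum>e\<in>E. indicator {b. b e} b :: ennreal)"
      unfolding of_nat_sum by (intro sum.cong) auto
    finally show ?thesis .
  qed
  then have "(\<integral>\<^sup>+ b. of_nat (card {e \<in> E. b e}) \<partial>bern_field E p) =
      (\<integral>\<^sup>+ b. (\<Sum>e\<in>E. indicator {b. b e} b) \<partial>bern_field E p)"
    by simp
  also have "\<dots> = (\<Sum>e\<in>E. emeasure (bern_field E p) {b. b e})"
    by (subst nn_integral_sum) auto
  also have "\<dots> = (\<Sum>e\<in>E. ennreal (p e))"
  proof (intro sum.cong refl)
    fix e assume e: "e \<in> E"
    have "emeasure (bern_field E p) {b. b e} =
        emeasure (map_pmf (\<lambda>b. b e) (bern_field E p)) {True}"
      by (simp add: vimage_def)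
    also have "\<dots> = ennreal (p e)"
      using assms e by (simp add: Pi_pmf_component emeasure_pmf_single)
    finally show "emeasure (bern_field E p) {b. b e} = ennreal (p e)" .
  qed
  finally show ?thesis using assms by simp
qed

text \<open>The Efron--Stein inequality for bounded differences, by induction on \<open>E\<close>.
  Conditioning on coordinate \<open>e\<close> splits the variance into the average of two
  conditional variances and the variance of the conditional mean, and the latter is at most
  \<open>p e * C\<^sup>2\<close>.\<close>

lemma bern_field_variance_le:
  fixes f :: "('e \<Rightarrow> bool) \<Rightarrow> real"
  assumes "finite E" "\<And>e. e \<in> E \<Longrightarrow> 0 \<le> p e" "\<And>e. e \<in> E \<Longrightarrow> p e \<le> 1"
    and "\<And>b e. e \<in> E \<Longrightarrow> \<bar>f (b(e := True)) - f (b(e := False))\<bar> \<le> C"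
  shows "measure_pmf.variance (bern_field E p) f \<le> C\<^sup>2 * sum p E"
  using assms
proof (induction E arbitrary: f rule: finite_induct)
  case empty
  then show ?case by simp
next
  case (insert e E)
  let ?q = "bern_field E p"
  let ?Ex = "measure_pmf.expectation ?q"
  define g where "g b = f (b(e := True))" for b
  define h where "h b = f (b(e := False))" for b
  have pe: "0 \<le> p e" "p e \<le> 1" using insert.prems by auto
  have C: "0 \<le> C" using insert.prems(3)[of e] by (meson abs_ge_zero insertI1 order_trans)
  define m where "m = p e * ?Ex g + (1 - p e) * ?Ex h"
  have m: "measure_pmf.expectation (bern_field (insert e E) p) f = m"
    unfolding m_def g_def h_def
    by (rule expectation_bern_field_insert) (use insert.hyps pe in auto)
  have int: "integrable ?q F" for F :: "('e \<Rightarrow> bool) \<Rightarrow> real" using insert.hyps by simp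
  \<comment> \<open>The mean square distance to any constant is the variance plus the squared
    bias.\<close>
  have shift: "?Ex (\<lambda>b. (F b - c)\<^sup>2) = measure_pmf.variance ?q F + (?Ex F - c)\<^sup>2"
    for F :: "('e \<Rightarrow> bool) \<Rightarrow> real" and c
  proof -
    have "?Ex (\<lambda>b. (F b - c)\<^sup>2) = ?Ex (\<lambda>b. (F b)\<^sup>2 - 2 * c * F b + c\<^sup>2)"
      by (intro Bochner_Integration.integral_cong) (auto simp: power2_eq_square algebra_simps)
    also have "\<dots> = ?Ex (\<lambda>b. (F b)\<^sup>2) - 2 * c * ?Ex F + c\<^sup>2"
      by (simp add: int)
    finally show ?thesis
      by (simp add: measure_pmf.variance_eq int) (simp add: power2_eq_square algebra_simps)
  qed
  have vg: "measure_pmf.variance ?q g \<le> C\<^sup>2 * sum p E"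
    and vh: "measure_pmf.variance ?q h \<le> C\<^sup>2 * sum p E"
  proof -
    \<comment> \<open>Updates at distinct coordinates commute, so \<open>g\<close> and
      \<open>h\<close> inherit the bounded differences of \<open>f\<close>.\<close>
    have comm: "b(e' := x, e := y) = b(e := y, e' := x)" if "e' \<in> E" for b :: "'e \<Rightarrow> bool" and e' x y
      using that insert.hyps by (intro fun_upd_twist) auto
    show "measure_pmf.variance ?q g \<le> C\<^sup>2 * sum p E"
    proof (intro insert.IH)
      fix b e' assume e': "e' \<in> E"
      show "\<bar>g (b(e' := True)) - g (b(e' := False))\<bar> \<le> C"
        unfolding g_def comm[OF e'] using e' by (intro insert.prems) auto
    qed (use insert.prems in auto)
    show "measure_pmf.variance ?q h \<le> C\<^sup>2 * sum p E"
    proof (intro insert.IH)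
      fix b e' assume e': "e' \<in> E"
      show "\<bar>h (b(e' := True)) - h (b(e' := False))\<bar> \<le> C"
        unfolding h_def comm[OF e'] using e' by (intro insert.prems) auto
    qed (use insert.prems in auto)
  qed
  have "\<bar>?Ex g - ?Ex h\<bar> \<le> C"
  proof -
    have "\<bar>?Ex (\<lambda>b. g b - h b)\<bar> \<le> ?Ex (\<lambda>b. \<bar>g b - h b\<bar>)"
      by (rule integral_abs_bound)
    also have "\<dots> \<le> C"
      by (intro measure_pmf.integral_le_const int always_eventually allI)
        (simp add: g_def h_def insert.prems(3) del: fun_upd_apply)
    finally show ?thesis by (simp add: int)
  qed
  then have d: "(?Ex g - ?Ex h)\<^sup>2 \<le> C\<^sup>2" by (simp add: abs_le_square_iff[symmetric])
  \<comment> \<open>The law of total variance for a mixture of two laws with means \<open>a\<close>,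
    \<open>b\<close> and variances \<open>V\<close>, \<open>W\<close>.\<close>
  have alg: "q * (V + (a - (q * a + (1 - q) * b))\<^sup>2) + (1 - q) * (W + (b - (q * a + (1 - q) * b))\<^sup>2) =
      q * V + (1 - q) * W + q * (1 - q) * (a - b)\<^sup>2" for q V W a b :: real
    by (simp add: power2_eq_square algebra_simps)
  have "measure_pmf.variance (bern_field (insert e E) p) f =
      p e * ?Ex (\<lambda>b. (g b - m)\<^sup>2) + (1 - p e) * ?Ex (\<lambda>b. (h b - m)\<^sup>2)"
    unfolding m unfolding g_def h_def
    by (rule expectation_bern_field_insert) (use insert.hyps pe in auto)
  also have "\<dots> = p e * measure_pmf.variance ?q g + (1 - p e) * measure_pmf.variance ?q h +
      p e * (1 - p e) * (?Ex g - ?Ex h)\<^sup>2"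
    unfolding shift[of g m] shift[of h m] unfolding m_def by (rule alg)
  also have "\<dots> \<le> p e * (C\<^sup>2 * sum p E) + (1 - p e) * (C\<^sup>2 * sum p E) + p e * C\<^sup>2"
  proof -
    have "p e * (1 - p e) * (?Ex g - ?Ex h)\<^sup>2 \<le> p e * C\<^sup>2"
      using d pe by (intro mult_mono mult_left_le) auto
    then show ?thesis
      using pe vg vh by (intro add_mono mult_left_mono) auto
  qed
  also have "\<dots> = C\<^sup>2 * sum p (insert e E)"
    using insert.hyps by (simp add: algebra_simps)
  finally show ?case .
qed

lemma bern_field_deviation_le:
  fixes f :: "('e \<Rightarrow> bool) \<Rightarrow> real"
  assumes "finite E" "\<And>e. e \<in> E \<Longrightarrow> 0 \<le> p e" "\<And>e. e \<in> E \<Longrightarrow> p e \<le> 1"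
    and "\<And>b e. e \<in> E \<Longrightarrow> \<bar>f (b(e := True)) - f (b(e := False))\<bar> \<le> C" and "0 < a"
  shows "measure (bern_field E p) {b. a \<le> \<bar>f b - measure_pmf.expectation (bern_field E p) f\<bar>}
    \<le> C\<^sup>2 * sum p E / a\<^sup>2"
proof -
  have "measure (bern_field E p) {b \<in> space (bern_field E p).
      a \<le> \<bar>f b - measure_pmf.expectation (bern_field E p) f\<bar>} \<le>
      measure_pmf.variance (bern_field E p) f / a\<^sup>2"
    using assms(1,5) by (intro measure_pmf.Chebyshev_inequality) auto
  also have "\<dots> \<le> C\<^sup>2 * sum p E / a\<^sup>2"
    using assms by (intro divide_right_mono bern_field_variance_le) auto
  finally show ?thesis by simp
qed

subsection \<open>Step minorants of a graphical sequence\<close>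

lemma eventually_at_top_in:
  "eventually Q (at_top_in I) \<longleftrightarrow> (\<exists>N. \<forall>n\<in>I. N \<le> n \<longrightarrow> Q n)"
  by (auto simp: at_top_in_def eventually_inf_principal eventually_at_top_linorder)

lemma at_top_in_neq_bot:
  assumes "\<not> bdd_above I"
  shows "at_top_in I \<noteq> bot"
proof
  assume "at_top_in I = bot"
  then have "eventually (\<lambda>_. False) (at_top_in I)" by simp
  then obtain N where "\<forall>n\<in>I. \<not> N \<le> n" unfolding eventually_at_top_in by blast
  then have "bdd_above I" by (intro bdd_aboveI[of _ N]) auto
  with assms show False by simp
qed

section \<open>Continuity sets: Boolean operations, balls and a countable basis\<close>

lemma continuity_set_UNIV: "continuity_set \<mu> UNIV"
  by (simp add: continuity_set_def)

lemma continuity_set_empty: "continuity_set \<mu> {}"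
  by (simp add: continuity_set_def)

lemma continuity_set_Compl: "continuity_set \<mu> A \<Longrightarrow> continuity_set \<mu> (- A)"
  by (auto simp: continuity_set_def frontier_complement)

lemma continuity_set_Int:
  assumes "sets \<mu> = sets borel" "continuity_set \<mu> A" "continuity_set \<mu> B"
  shows "continuity_set \<mu> (A \<inter> B)"
proof -
  have "emeasure \<mu> (frontier (A \<inter> B)) \<le> emeasure \<mu> (frontier A \<union> frontier B)"
    using assms(1) by (intro emeasure_mono frontier_Int_subset) auto
  also have "\<dots> \<le> emeasure \<mu> (frontier A) + emeasure \<mu> (frontier B)"
    using assms(1) by (intro emeasure_subadditive) auto
  also have "\<dots> = 0" using assms by (simp add: continuity_set_def)
  finally show ?thesis using assms by (auto simp: continuity_set_def)
qed

lemma continuity_set_INT: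
  assumes "sets \<mu> = sets borel" "finite J" "\<And>i. i \<in> J \<Longrightarrow> continuity_set \<mu> (A i)"
  shows "continuity_set \<mu> (\<Inter>i\<in>J. A i)"
  using assms(2,3)
  by (induction J rule: finite_induct)
     (auto simp: continuity_set_UNIV intro!: continuity_set_Int[OF assms(1)])

text \<open>The frontier of a ball lies in a sphere. Spheres about \<open>x\<close> of different
  radii are disjoint, so in a finite measure only countably many have positive mass, whereas the
  interval of admissible radii is uncountable.\<close>

lemma ex_continuity_ball:
  fixes x :: "'a :: {metric_space, second_countable_topology}"
  assumes "finite_measure M" and M: "sets M = sets borel" and r: "0 < r"
  shows "\<exists>s. r < s \<and> s < 2 * r \<and> continuity_set M (ball x s)"
proof -
  interpret finite_measure M by fact
  \<comment> \<open>The law of the distance from \<open>x\<close>; its atoms are the radii of the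
    spheres of positive mass.\<close>
  let ?D = "distr M borel (dist x)"
  have meas: "dist x \<in> measurable M borel"
    unfolding measurable_cong_sets[OF M refl] by (intro borel_measurable_continuous_onI continuous_intros)
  interpret D: finite_measure ?D by (rule finite_measure_distr[OF meas])
  have "countable {t. measure ?D {t} \<noteq> 0}" by (rule D.countable_support)
  moreover have "uncountable {r<..<2 * r}" using r by (simp add: uncountable_open_interval)
  ultimately have "\<not> {r<..<2 * r} \<subseteq> {t. measure ?D {t} \<noteq> 0}"
    using countable_subset by blast
  then obtain s where s: "r < s" "s < 2 * r" "measure ?D {s} = 0" by auto
  have "frontier (ball x s) \<subseteq> dist x -` {s}"
  proof
    fix y assume y: "y \<in> frontier (ball x s)"
    have "closure (ball x s) \<subseteq> cball x s" by (rule closure_minimal) auto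
    with y show "y \<in> dist x -` {s}" by (auto simp: frontier_def)
  qed
  then have "emeasure M (frontier (ball x s)) \<le> emeasure M (dist x -` {s} \<inter> space M)"
    using M sets_eq_imp_space_eq[OF M] by (intro emeasure_mono measurable_sets[OF meas]) auto
  also have "\<dots> = emeasure ?D {s}"
    by (subst emeasure_distr[OF meas]) auto
  also have "\<dots> = 0" using s(3) by (simp add: D.emeasure_eq_measure)
  finally have "continuity_set M (ball x s)" by (simp add: continuity_set_def)
  with s show ?thesis by blast
qed

text \<open>Continuity balls about the points of a countable dense set, with radii between
  \<open>r j\<close> and \<open>2 * r j\<close>. The centre and \<open>j\<close> are coded into one
  index by \<open>prod_decode\<close>.\<close>

lemma ex_continuity_basis:
  fixes M :: "'a :: {metric_space, second_countable_topology} measure"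
  assumes fin: "finite_measure M" and M: "sets M = sets borel"
  shows "\<exists>B :: nat \<Rightarrow> 'a set. (\<forall>i. continuity_set M (B i)) \<and>
    (\<forall>x e. 0 < e \<longrightarrow> (\<exists>i. x \<in> B i \<and> B i \<subseteq> ball x e))"
proof -
  obtain D :: "'a set" where D: "countable D" "\<And>U. open U \<Longrightarrow> U \<noteq> {} \<Longrightarrow> \<exists>d\<in>D. d \<in> U"
    by (rule countable_dense_setE) blast
  have D0: "D \<noteq> {}" using D(2)[of UNIV] by auto
  define r where "r j = 1 / (real j + 1)" for j :: nat
  have r: "0 < r j" for j by (simp add: r_def)
  obtain s where s: "\<And>x j. r j < s x j" "\<And>x j. s x j < 2 * r j"
      "\<And>x j. continuity_set M (ball x (s x j))"
  proof -
    have "\<forall>x j. \<exists>s. r j < s \<and> s < 2 * r j \<and> continuity_set M (ball x s)"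
      using ex_continuity_ball[OF fin M r] by blast
    then obtain s where "\<forall>x j. r j < s x j \<and> s x j < 2 * r j \<and> continuity_set M (ball x (s x j))"
      unfolding choice_iff by blast
    then show thesis by (intro that) auto
  qed
  define B where "B i = (case prod_decode i of (a, j) \<Rightarrow>
      ball (from_nat_into D a) (s (from_nat_into D a) j))" for i
  have "\<exists>i. x \<in> B i \<and> B i \<subseteq> ball x e" if e: "0 < e" for x e
  proof -
    \<comment> \<open>The third of \<open>e\<close> leaves room for the distance from
      \<open>x\<close> to the centre, below \<open>r j\<close>, plus the radius of the ball, below
      \<open>2 * r j\<close>.\<close>
    obtain j where j: "inverse (real (Suc j)) < e / 3"
      using reals_Archimedean[of "e / 3"] e by auto
    then have rj: "3 * r j < e" by (simp add: r_def field_simps)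
    obtain d where d: "d \<in> D" "dist x d < r j"
      using D(2)[of "ball x (r j)"] r[of j] by (auto simp: ball_eq_empty)
    obtain a where a: "from_nat_into D a = d"
      using from_nat_into_surj[OF D(1) d(1)] by blast
    have B: "B (prod_encode (a, j)) = ball d (s d j)" by (simp add: B_def a)
    have "x \<in> ball d (s d j)" using d s(1)[of j d] by (simp add: dist_commute)
    moreover have "ball d (s d j) \<subseteq> ball x e"
    proof
      fix y assume "y \<in> ball d (s d j)"
      then have "dist x y < r j + 2 * r j"
        using d(2) s(2)[of d j] dist_triangle[of x y d] by simp
      then show "y \<in> ball x e" using rj by simp
    qed
    ultimately show ?thesis using B by blast
  qed
  moreover have "continuity_set M (B i)" for i
    by (simp add: B_def s(3) split: prod.split)
  ultimately show ?thesis by blast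
qed

text \<open>A label of the atom containing \<open>x\<close> in the partition generated by the first
  \<open>m\<close> sets. The partitions refine as \<open>m\<close> grows.\<close>

definition cell :: "(nat \<Rightarrow> 'a set) \<Rightarrow> nat \<Rightarrow> 'a \<Rightarrow> nat set" where
  "cell B m x = {i. i < m \<and> x \<in> B i}"

lemma finite_range_cell: "finite (range (cell B m))"
  by (rule finite_subset[of _ "Pow {..<m}"]) (auto simp: cell_def)

text \<open>An atom is a finite intersection of sets \<open>B i\<close> and complements of such
  sets; a label with an element outside \<open>{..<m}\<close> is not attained.\<close>

lemma continuity_set_cell:
  assumes "sets \<mu> = sets borel" "\<And>i. continuity_set \<mu> (B i)"
  shows "continuity_set \<mu> {x. cell B m x = a}"
proof (cases "a \<subseteq> {..<m}")
  case True
  then have "{x. cell B m x = a} = (\<Inter>i\<in>{..<m}. if i \<in> a then B i else - B i)"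
    by (auto simp: cell_def split: if_splits)
  moreover have "continuity_set \<mu> (if i \<in> a then B i else - B i)" for i
    using assms(2) by (simp add: continuity_set_Compl)
  ultimately show ?thesis
    using continuity_set_INT[OF assms(1), of "{..<m}" "\<lambda>i. if i \<in> a then B i else - B i"]
    by simp
next
  case False
  then have "{x. cell B m x = a} = {}" by (auto simp: cell_def)
  then show ?thesis by (simp add: continuity_set_empty)
qed

text \<open>Including \<open>m\<close> in the set keeps the infimum bounded and off the empty set.\<close>

definition cell_inf ::
    "real set \<Rightarrow> (real \<Rightarrow> 'a \<Rightarrow> 'a \<Rightarrow> real) \<Rightarrow> ('a \<Rightarrow> 'b) \<Rightarrow> nat \<Rightarrow> 'b \<Rightarrow> 'b \<Rightarrow> real" where
  "cell_inf I \<kappa>s \<tau> m a b =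
     Inf (insert (real m) {\<kappa>s n x y | n x y. n \<in> I \<and> real m \<le> n \<and> \<tau> x = a \<and> \<tau> y = b})"

lemma cell_inf_bounds:
  assumes "\<And>n x y. n \<in> I \<Longrightarrow> 0 \<le> \<kappa>s n x y"
  shows "0 \<le> cell_inf I \<kappa>s \<tau> m a b" "cell_inf I \<kappa>s \<tau> m a b \<le> real m"
    and "n \<in> I \<Longrightarrow> real m \<le> n \<Longrightarrow> cell_inf I \<kappa>s \<tau> m (\<tau> x) (\<tau> y) \<le> \<kappa>s n x y"
proof -
  have bdd: "bdd_below (insert (real m) {\<kappa>s n x y | n x y. n \<in> I \<and> real m \<le> n \<and> \<tau> x = a \<and> \<tau> y = b})"
    for a b using assms by (intro bdd_belowI[of _ 0]) auto
  show "0 \<le> cell_inf I \<kappa>s \<tau> m a b"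
    unfolding cell_inf_def using assms by (intro cInf_greatest) auto
  show "cell_inf I \<kappa>s \<tau> m a b \<le> real m"
    unfolding cell_inf_def by (intro cInf_lower bdd) auto
  show "n \<in> I \<Longrightarrow> real m \<le> n \<Longrightarrow> cell_inf I \<kappa>s \<tau> m (\<tau> x) (\<tau> y) \<le> \<kappa>s n x y"
    unfolding cell_inf_def by (intro cInf_lower bdd) auto
qed

text \<open>A failure along arbitrarily large indices is turned into a pair of nets by inserting the
  bad points at a strictly increasing sequence of indices and the limit point elsewhere.\<close>

lemma net_convergence_uniform_lower_bound:
  fixes y z :: "'a :: metric_space"
  assumes net: "\<And>ys zs. (ys \<longlongrightarrow> y) (at_top_in I) \<Longrightarrow> (zs \<longlongrightarrow> z) (at_top_in I) \<Longrightarrow>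
      ((\<lambda>n. f n (ys n) (zs n)) \<longlongrightarrow> (L :: real)) (at_top_in I)"
    and e: "0 < e"
  shows "\<exists>N d. 0 < d \<and> (\<forall>n\<in>I. N \<le> n \<longrightarrow>
    (\<forall>y' z'. dist y y' < d \<longrightarrow> dist z z' < d \<longrightarrow> L - e < f n y' z'))"
proof (rule ccontr)
  assume neg: "\<not> ?thesis"
  have ex: "\<exists>n\<in>I. N \<le> n \<and> (\<exists>y' z'. dist y y' < d \<and> dist z z' < d \<and> f n y' z' \<le> L - e)"
    if "0 < d" for N d
    using neg that by (meson linorder_not_le)
  \<comment> \<open>The bound \<open>real j \<le> n\<close> pushes the chosen indices to infinity,
    and the shrinking radius makes the bad points converge to \<open>y\<close> and
    \<open>z\<close>.\<close>
  define bad where "bad j n \<longleftrightarrow> n \<in> I \<and> real j \<le> n \<and>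
      (\<exists>y' z'. dist y y' < inverse (real (Suc j)) \<and> dist z z' < inverse (real (Suc j)) \<and> f n y' z' \<le> L - e)"
    for j n
  have "\<exists>nn. \<forall>j. bad j (nn j) \<and> nn j < nn (Suc j)"
  proof (rule dependent_nat_choice)
    show "\<exists>n. bad 0 n"
      using ex[of 1 0] by (auto simp: bad_def)
    show "\<exists>n'. bad (Suc j) n' \<and> n < n'" for n j
      using ex[of "inverse (real (Suc (Suc j)))" "max (n + 1) (real (Suc j))"]
      by (auto simp: bad_def simp del: of_nat_Suc) (metis less_add_one order_less_le_trans)
  qed
  then obtain nn where nn: "\<And>j. bad j (nn j)" "\<And>j. nn j < nn (Suc j)" by blast
  have mono: "strict_mono nn" using nn(2) by (simp add: strict_mono_Suc_iff)
  then have inj: "inj nn" by (rule strict_mono_imp_inj_on)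
  obtain py pz where p: "\<And>j. dist y (py j) < inverse (real (Suc j))"
      "\<And>j. dist z (pz j) < inverse (real (Suc j))" "\<And>j. f (nn j) (py j) (pz j) \<le> L - e"
    using nn(1) unfolding bad_def by metis
  define ys where "ys n = (if n \<in> range nn then py (inv nn n) else y)" for n
  define zs where "zs n = (if n \<in> range nn then pz (inv nn n) else z)" for n
  have conv: "((\<lambda>n. if n \<in> range nn then q (inv nn n) else c) \<longlongrightarrow> c) (at_top_in I)"
    if q: "\<And>j. dist c (q j) < inverse (real (Suc j))" for q :: "nat \<Rightarrow> 'a" and c
  proof (rule tendstoI)
    fix d :: real assume d: "0 < d"
    obtain J where J: "inverse (real (Suc J)) < d" using reals_Archimedean[OF d] by auto
    have "dist (if n \<in> range nn then q (inv nn n) else c) c < d" if "nn J \<le> n" for n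
    proof (cases "n \<in> range nn")
      case True
      then obtain j where j: "n = nn j" by blast
      with that mono have "J \<le> j" by (simp add: strict_mono_less_eq)
      then have "inverse (real (Suc j)) \<le> inverse (real (Suc J))" by simp
      then have "dist c (q j) < d" using q[of j] J by linarith
      then show ?thesis by (simp add: j inv_f_f[OF inj] dist_commute)
    qed (use d in simp)
    then show "eventually (\<lambda>n. dist (if n \<in> range nn then q (inv nn n) else c) c < d) (at_top_in I)"
      unfolding eventually_at_top_in by blast
  qed
  have "((\<lambda>n. f n (ys n) (zs n)) \<longlongrightarrow> L) (at_top_in I)"
    unfolding ys_def zs_def by (intro net conv p)
  then have "eventually (\<lambda>n. dist (f n (ys n) (zs n)) L < e) (at_top_in I)"
    using e by (rule tendstoD)
  then obtain N where N: "\<And>n. n \<in> I \<Longrightarrow> N \<le> n \<Longrightarrow> dist (f n (ys n) (zs n)) L < e"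
    unfolding eventually_at_top_in by blast
  obtain j :: nat where j: "N \<le> real j" using real_arch_simple by blast
  have "nn j \<in> I" "N \<le> nn j" using nn(1)[of j] j by (auto simp: bad_def)
  from N[OF this] p(3)[of j] show False
    by (simp add: ys_def zs_def inv_f_f[OF inj] dist_real_def)
qed

text \<open>The infimum is at most \<open>\<kappa>s n y z\<close> for all large \<open>n\<close>,
  which tends to \<open>L\<close> by taking constant nets. Conversely, for large \<open>m\<close>
  the cells of \<open>y\<close> and \<open>z\<close> lie in balls so small that all kernels of large
  index exceed \<open>L - r / 2\<close> there.\<close>

lemma cell_inf_converges:
  fixes y z :: "'a :: metric_space"
  assumes net: "\<And>ys zs. (ys \<longlongrightarrow> y) (at_top_in I) \<Longrightarrow> (zs \<longlongrightarrow> z) (at_top_in I) \<Longrightarrow>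
      ((\<lambda>n. \<kappa>s n (ys n) (zs n)) \<longlongrightarrow> L) (at_top_in I)"
    and B: "\<And>x e. 0 < e \<Longrightarrow> \<exists>i. x \<in> B i \<and> B i \<subseteq> ball x e"
    and nonneg: "\<And>n x y. n \<in> I \<Longrightarrow> 0 \<le> \<kappa>s n x y"
    and I: "\<not> bdd_above I"
  shows "cell_inf I \<kappa>s (cell B m) m (cell B m y) (cell B m z) \<le> L"
    and "(\<lambda>m. cell_inf I \<kappa>s (cell B m) m (cell B m y) (cell B m z)) \<longlonglongrightarrow> L"
proof -
  show le: "cell_inf I \<kappa>s (cell B m) m (cell B m y) (cell B m z) \<le> L" for m
  proof (rule tendsto_lowerbound)
    show "((\<lambda>n. \<kappa>s n y z) \<longlongrightarrow> L) (at_top_in I)" by (rule net) simp_all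
    show "eventually (\<lambda>n. cell_inf I \<kappa>s (cell B m) m (cell B m y) (cell B m z) \<le> \<kappa>s n y z) (at_top_in I)"
      unfolding eventually_at_top_in using cell_inf_bounds(3)[of I \<kappa>s, OF nonneg] by blast
  qed (rule at_top_in_neq_bot[OF I])
  show "(\<lambda>m. cell_inf I \<kappa>s (cell B m) m (cell B m y) (cell B m z)) \<longlonglongrightarrow> L"
  proof (rule LIMSEQ_I)
    fix r :: real assume r: "0 < r"
    obtain N d where d: "0 < d" and low: "\<And>n y' z'. n \<in> I \<Longrightarrow> N \<le> n \<Longrightarrow> dist y y' < d \<Longrightarrow>
        dist z z' < d \<Longrightarrow> L - r / 2 < \<kappa>s n y' z'"
      using net_convergence_uniform_lower_bound[where y = y and z = z and L = L and f = \<kappa>s,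
        OF net, of "r / 2"] r
      by fastforce
    obtain i j where i: "y \<in> B i" "B i \<subseteq> ball y d" and j: "z \<in> B j" "B j \<subseteq> ball z d"
      using B[OF d] by meson
    \<comment> \<open>Beyond \<open>N\<close> only indices with the uniform lower bound enter the
      infimum; beyond \<open>L\<close> the inserted element \<open>real m\<close> is harmless;
      beyond \<open>i\<close> and \<open>j\<close> the cells lie in \<open>B i\<close> and
      \<open>B j\<close>.\<close>
    obtain M :: nat where M: "max (max N L) (real (max i j) + 1) \<le> real M"
      using real_arch_simple by blast
    have "norm (cell_inf I \<kappa>s (cell B m) m (cell B m y) (cell B m z) - L) < r" if m: "M \<le> m" for m
    proof -
      have m': "N \<le> real m" "L \<le> real m" "i < m" "j < m" using M m by auto
      have "L - r / 2 \<le> cell_inf I \<kappa>s (cell B m) m (cell B m y) (cell B m z)"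
        unfolding cell_inf_def
      proof (rule cInf_greatest)
        fix t assume "t \<in> insert (real m) {\<kappa>s n x' y' |n x' y'. n \<in> I \<and> real m \<le> n \<and>
            cell B m x' = cell B m y \<and> cell B m y' = cell B m z}"
        then consider "t = real m" | n y' z' where "t = \<kappa>s n y' z'" "n \<in> I" "real m \<le> n"
            "cell B m y' = cell B m y" "cell B m z' = cell B m z"
          by blast
        then show "L - r / 2 \<le> t"
        proof cases
          case 2
          have "y' \<in> B i" "z' \<in> B j"
            using 2(4,5) i(1) j(1) m'(3,4) by (auto simp: cell_def)
          then have "dist y y' < d" "dist z z' < d" using i(2) j(2) by auto
          with low[of n y' z'] 2 m' show ?thesis by simp
        qed (use m' r in simp)
      qed simp
      with le[of m] r show ?thesis by simp
    qed
    then show "\<exists>no. \<forall>m\<ge>no. norm (cell_inf I \<kappa>s (cell B m) m (cell B m y) (cell B m z) - L) < r"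
      by blast
  qed
qed

text \<open>Exactly one summand survives. This form of a function of the type \<open>\<tau>\<close>
  serves for measurability, for integrals and for averages over the vertices alike.\<close>

lemma sum_indicator_fibre:
  fixes f :: "'b \<Rightarrow> real"
  assumes "finite (range \<tau>)"
  shows "(\<Sum>a\<in>range \<tau>. f a * indicator {x. \<tau> x = a} y) = f (\<tau> y)"
proof -
  have "(\<Sum>a\<in>range \<tau> - {\<tau> y}. f a * indicator {x. \<tau> x = a} y) = 0"
    by (intro sum.neutral) (auto simp: indicator_def)
  then show ?thesis
    using assms by (subst sum.remove[of _ "\<tau> y"]) auto
qed

lemma measurable_step_function:
  fixes c :: "'b \<Rightarrow> 'b \<Rightarrow> real"
  assumes "finite (range \<tau>)" "\<And>a. {x. \<tau> x = a} \<in> sets M"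
  shows "(\<lambda>(x, y). c (\<tau> x) (\<tau> y)) \<in> borel_measurable (M \<Otimes>\<^sub>M M)"
proof -
  have ind [measurable]: "(indicator {x. \<tau> x = a} :: _ \<Rightarrow> real) \<in> borel_measurable M" for a
    using assms(2) by (intro borel_measurable_indicator)
  have "(\<lambda>p. \<Sum>a\<in>range \<tau>. (\<Sum>b\<in>range \<tau>. c a b * indicator {x. \<tau> x = b} (snd p)) *
      indicator {x. \<tau> x = a} (fst p)) \<in> borel_measurable (M \<Otimes>\<^sub>M M)"
    by (intro borel_measurable_sum borel_measurable_times borel_measurable_const
        measurable_compose[OF measurable_fst ind] measurable_compose[OF measurable_snd ind])
  then show ?thesis
    by (simp add: sum_indicator_fibre[OF assms(1)] case_prod_unfold)
qed

text \<open>The cell infima converge to \<open>\<kappa>\<close> almost everywhere and are dominated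
  by it, so their integrals converge and a large \<open>m\<close> suffices. The same
  \<open>m\<close> is the number of sets generating the cells, the bound on the values and the index
  from which the minorization holds.\<close>

lemma (in generalized_vertex_space) ex_step_minorant:
  assumes g: "graphical \<mu> I P X \<kappa>s \<kappa>" and e: "0 < e"
  shows "\<exists>(\<tau> :: 'a \<Rightarrow> nat set) (c :: nat set \<Rightarrow> nat set \<Rightarrow> real) m :: nat.
    finite (range \<tau>) \<and> (\<forall>a. continuity_set \<mu> {x. \<tau> x = a}) \<and>
    (\<forall>a b. 0 \<le> c a b \<and> c a b \<le> real m) \<and>
    (\<forall>n\<in>I. real m \<le> n \<longrightarrow> (\<forall>x y. c (\<tau> x) (\<tau> y) \<le> \<kappa>s n x y)) \<and>
    (AE (x, y) in \<mu> \<Otimes>\<^sub>M \<mu>. c (\<tau> x) (\<tau> y) \<le> \<kappa> x y) \<and>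
    (\<integral>p. case_prod \<kappa> p \<partial>(\<mu> \<Otimes>\<^sub>M \<mu>)) - (\<integral>(x, y). c (\<tau> x) (\<tau> y) \<partial>(\<mu> \<Otimes>\<^sub>M \<mu>)) < e"
proof -
  obtain B :: "nat \<Rightarrow> 'a set" where B: "\<And>i. continuity_set \<mu> (B i)"
      "\<And>x e. 0 < e \<Longrightarrow> \<exists>i. x \<in> B i \<and> B i \<subseteq> ball x e"
    using ex_continuity_basis[OF finite_measure_axioms sets_mu] by blast
  define K where "K m = (\<lambda>(x, y). cell_inf I \<kappa>s (cell B m) m (cell B m x) (cell B m y))" for m
  have nonneg: "\<And>n x y. n \<in> I \<Longrightarrow> 0 \<le> \<kappa>s n x y"
    using g by (auto simp: graphical_def is_kernel_def)
  have cont: "continuity_set \<mu> {x. cell B m x = a}" for m a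
    by (rule continuity_set_cell[OF sets_mu B(1)])
  have int: "integrable (\<mu> \<Otimes>\<^sub>M \<mu>) (case_prod \<kappa>)"
    using g by (simp add: graphical_def)
  have AE: "AE p in \<mu> \<Otimes>\<^sub>M \<mu>. (\<forall>m. K m p \<le> case_prod \<kappa> p) \<and> (\<lambda>m. K m p) \<longlonglongrightarrow> case_prod \<kappa> p"
  proof -
    have "AE (y, z) in \<mu> \<Otimes>\<^sub>M \<mu>. \<forall>ys zs. (ys \<longlongrightarrow> y) (at_top_in I) \<longrightarrow> (zs \<longlongrightarrow> z) (at_top_in I) \<longrightarrow>
        ((\<lambda>n. \<kappa>s n (ys n) (zs n)) \<longlongrightarrow> \<kappa> y z) (at_top_in I)"
      using g by (simp add: graphical_def)
    then show ?thesis
    proof eventually_elim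
      case (elim p)
      obtain y z where p: "p = (y, z)" by force
      show ?case
        unfolding p K_def prod.case
        using cell_inf_converges[where L = "\<kappa> y z", OF _ B(2) nonneg index_unbounded] elim
        by (auto simp: p)
    qed
  qed
  have meas: "K m \<in> borel_measurable (\<mu> \<Otimes>\<^sub>M \<mu>)" for m
    unfolding K_def using cont
    by (intro measurable_step_function finite_range_cell) (auto simp: continuity_set_def sets_mu)
  have "(\<lambda>m. \<integral>p. K m p \<partial>(\<mu> \<Otimes>\<^sub>M \<mu>)) \<longlonglongrightarrow> (\<integral>p. case_prod \<kappa> p \<partial>(\<mu> \<Otimes>\<^sub>M \<mu>))"
  proof (rule integral_dominated_convergence[OF _ _ int])
    show "AE p in \<mu> \<Otimes>\<^sub>M \<mu>. norm (K m p) \<le> case_prod \<kappa> p" for m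
      using AE by eventually_elim
        (auto simp: K_def abs_of_nonneg cell_inf_bounds[of I \<kappa>s, OF nonneg] split: prod.splits)
    show "AE p in \<mu> \<Otimes>\<^sub>M \<mu>. (\<lambda>m. K m p) \<longlonglongrightarrow> case_prod \<kappa> p"
      using AE by eventually_elim auto
  qed (use int meas in auto)
  from LIMSEQ_D[OF this e] obtain m
    where m: "norm ((\<integral>p. K m p \<partial>(\<mu> \<Otimes>\<^sub>M \<mu>)) - (\<integral>p. case_prod \<kappa> p \<partial>(\<mu> \<Otimes>\<^sub>M \<mu>))) < e"
    by blast
  have "AE p in \<mu> \<Otimes>\<^sub>M \<mu>. K m p \<le> case_prod \<kappa> p"
    using AE by eventually_elim auto
  moreover have "(\<integral>p. case_prod \<kappa> p \<partial>(\<mu> \<Otimes>\<^sub>M \<mu>)) - (\<integral>p. K m p \<partial>(\<mu> \<Otimes>\<^sub>M \<mu>)) < e"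
    using m by (simp add: abs_less_iff)
  ultimately show ?thesis
    using cont finite_range_cell cell_inf_bounds[of I \<kappa>s, OF nonneg]
    by (intro exI[of _ "cell B m"] exI[of _ "cell_inf I \<kappa>s (cell B m) m"] exI[of _ m])
      (auto simp: K_def case_prod_unfold)
qed

subsection \<open>Degrees in the random graph given the points\<close>

definition incident :: "nat \<Rightarrow> nat \<Rightarrow> (nat \<times> nat) set" where
  "incident v i = {e \<in> vertex_pairs v. fst e = i \<or> snd e = i}"

text \<open>The order \<open>i < j\<close> makes a pair recoverable from the edge it represents, so
  edges can be counted by counting pairs.\<close>

lemma inj_on_vertex_pairs: "inj_on (\<lambda>(i, j). {i, j}) (vertex_pairs v)"
  by (auto simp: inj_on_def vertex_pairs_def doubleton_eq_iff)

lemma edges_graph_of_indicator: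
  "edges (graph_of_indicator v b) = (\<lambda>(i, j). {i, j}) ` {e \<in> vertex_pairs v. b e}"
  by (auto simp: edges_def graph_of_indicator_def image_iff)

lemma card_edges_graph_of_indicator:
  "card (edges (graph_of_indicator v b)) = card {e \<in> vertex_pairs v. b e}"
  unfolding edges_graph_of_indicator
  by (intro card_image inj_on_subset[OF inj_on_vertex_pairs]) auto

lemma vertex_degree_graph_of_indicator:
  "vertex_degree (graph_of_indicator v b) i = card {e \<in> incident v i. b e}"
proof -
  have "{e \<in> edges (graph_of_indicator v b). i \<in> e} = (\<lambda>(i, j). {i, j}) ` {e \<in> incident v i. b e}"
    unfolding edges_graph_of_indicator by (auto simp: incident_def)
  moreover have "inj_on (\<lambda>(i, j). {i, j}) {e \<in> incident v i. b e}"
    by (intro inj_on_subset[OF inj_on_vertex_pairs]) (auto simp: incident_def)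
  ultimately show ?thesis
    by (simp add: vertex_degree_def card_image)
qed

lemma num_degree_graph_of_indicator:
  "num_degree k (graph_of_indicator v b) = card {i. i < v \<and> card {e \<in> incident v i. b e} = k}"
  by (simp add: num_degree_def vertex_degree_graph_of_indicator)
    (simp add: verts_def graph_of_indicator_def)

text \<open>An incident pair is determined by its other endpoint; \<open>min\<close> and
  \<open>max\<close> restore the order of the pair.\<close>

lemma sum_incident:
  assumes "i < v"
  shows "(\<Sum>e\<in>incident v i. g e) = (\<Sum>j\<in>{..<v} - {i}. g (min i j, max i j))"
  using assms
  by (intro sum.reindex_bij_witness[of _ "\<lambda>j. (min i j, max i j)" "\<lambda>e. if fst e = i then snd e else fst e"])
    (auto simp: incident_def vertex_pairs_def)

text \<open>Double counting: each pair is incident with exactly two vertices.\<close>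

lemma sum_sum_incident:
  fixes f :: "nat \<times> nat \<Rightarrow> real"
  shows "(\<Sum>i<v. \<Sum>e\<in>incident v i. f e) = 2 * sum f (vertex_pairs v)"
proof -
  have "(\<Sum>i<v. \<Sum>e\<in>incident v i. f e) =
      (\<Sum>i<v. \<Sum>e\<in>vertex_pairs v. if fst e = i \<or> snd e = i then f e else 0)"
    unfolding incident_def by (intro sum.cong refl sum.inter_filter finite_vertex_pairs)
  also have "\<dots> = (\<Sum>e\<in>vertex_pairs v. \<Sum>i<v. if fst e = i \<or> snd e = i then f e else 0)"
    by (rule sum.swap)
  also have "\<dots> = (\<Sum>e\<in>vertex_pairs v. 2 * f e)"
  proof (intro sum.cong refl)
    fix e assume "e \<in> vertex_pairs v"
    then have e: "fst e < snd e" "snd e < v" by (auto simp: vertex_pairs_def)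
    have "(\<Sum>i<v. if fst e = i \<or> snd e = i then f e else 0) = (\<Sum>i\<in>{fst e, snd e}. f e)"
      using e by (intro sum.mono_neutral_cong_right) auto
    then show "(\<Sum>i<v. if fst e = i \<or> snd e = i then f e else 0) = 2 * f e" using e by simp
  qed
  finally show ?thesis by (simp add: sum_distrib_left)
qed

definition edge_prob :: "real \<Rightarrow> ('a \<Rightarrow> 'a \<Rightarrow> real) \<Rightarrow> 'a list \<Rightarrow> nat \<Rightarrow> nat \<Rightarrow> real" where
  "edge_prob n \<kappa> xs i j = min (\<kappa> (xs ! i) (xs ! j) / n) 1"

lemma edge_prob_bounds:
  assumes "is_kernel \<kappa>" "0 < n"
  shows "0 \<le> edge_prob n \<kappa> xs i j" "edge_prob n \<kappa> xs i j \<le> 1"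
  using assms by (auto simp: edge_prob_def is_kernel_def)

lemma edge_prob_commute: "is_kernel \<kappa> \<Longrightarrow> edge_prob n \<kappa> xs i j = edge_prob n \<kappa> xs j i"
  by (simp add: edge_prob_def is_kernel_def)

text \<open>For a kernel and \<open>n > 0\<close>, twice the conditional expected number of edges
  divided by \<open>n\<close>. Along a graphical sequence its mean tends to the double integral of
  the limit kernel.\<close>

definition scaled_degree_sum :: "real \<Rightarrow> ('a \<Rightarrow> 'a \<Rightarrow> real) \<Rightarrow> 'a list \<Rightarrow> real" where
  "scaled_degree_sum n \<kappa> xs =
     (\<Sum>i<length xs. \<Sum>j\<in>{..<length xs} - {i}. edge_prob n \<kappa> xs i j) / n"

lemma graph_given_eq_map:
  "graph_given n \<kappa> xs = map_pmf (graph_of_indicator (length xs))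
     (bern_field (vertex_pairs (length xs)) (\<lambda>e. edge_prob n \<kappa> xs (fst e) (snd e)))"
  by (simp add: graph_given_def edge_prob_def case_prod_unfold)

lemma sum_incident_edge_prob:
  assumes "is_kernel \<kappa>" "i < length xs"
  shows "(\<Sum>e\<in>incident (length xs) i. h (edge_prob n \<kappa> xs (fst e) (snd e))) =
    (\<Sum>j\<in>{..<length xs} - {i}. h (edge_prob n \<kappa> xs i j))"
  unfolding sum_incident[OF assms(2)]
  by (intro sum.cong refl) (auto simp: min_def max_def edge_prob_commute[OF assms(1)])

lemma sum_edge_prob:
  assumes "is_kernel \<kappa>" "0 < n"
  shows "(\<Sum>e\<in>vertex_pairs (length xs). edge_prob n \<kappa> xs (fst e) (snd e)) =
    n * scaled_degree_sum n \<kappa> xs / 2"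
proof -
  have "(\<Sum>i<length xs. \<Sum>j\<in>{..<length xs} - {i}. edge_prob n \<kappa> xs i j) =
      (\<Sum>i<length xs. \<Sum>e\<in>incident (length xs) i. edge_prob n \<kappa> xs (fst e) (snd e))"
    using sum_incident_edge_prob[OF assms(1), of _ xs "\<lambda>x. x"] by (intro sum.cong) auto
  then show ?thesis
    using assms(2) by (simp add: scaled_degree_sum_def sum_sum_incident)
qed

lemma nn_integral_card_edges_graph_given:
  assumes "is_kernel \<kappa>" "0 < n"
  shows "(\<integral>\<^sup>+ g. of_nat (card (edges g)) \<partial>graph_given n \<kappa> xs) =
    ennreal (n * scaled_degree_sum n \<kappa> xs / 2)"
  by (simp add: graph_given_eq_map card_edges_graph_of_indicator nn_integral_card_bern_field
      finite_vertex_pairs edge_prob_bounds[OF assms] sum_edge_prob[OF assms])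

text \<open>By linearity the expectation is the sum over the vertices of the probability of degree
  \<open>k\<close>. The edges at one vertex are independent, so Le Cam's inequality applies to each
  summand; dependence between the degrees does not affect the mean.\<close>

lemma expectation_num_degree:
  assumes "is_kernel \<kappa>" "0 < n"
  shows "\<bar>measure_pmf.expectation (graph_given n \<kappa> xs) (\<lambda>g. real (num_degree k g)) -
      (\<Sum>i<length xs. poisson_weight k (\<Sum>j\<in>{..<length xs} - {i}. edge_prob n \<kappa> xs i j))\<bar>
    \<le> 2 * (\<Sum>i<length xs. \<Sum>j\<in>{..<length xs} - {i}. (edge_prob n \<kappa> xs i j)\<^sup>2)"
proof -
  define v where "v = length xs"
  define p where "p e = edge_prob n \<kappa> xs (fst e) (snd e)" for e
  let ?q = "bern_field (vertex_pairs v) p"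
  have "real (card {i. i < v \<and> card {e \<in> incident v i. b e} = k}) =
      (\<Sum>i<v. indicator {b. card {e \<in> incident v i. b e} = k} b)" for b
  proof -
    have "card {i. i < v \<and> card {e \<in> incident v i. b e} = k} =
        (\<Sum>i<v. if card {e \<in> incident v i. b e} = k then 1 else 0)"
      by (simp add: sum.If_cases Int_def)
    also have "real \<dots> = (\<Sum>i<v. indicator {b. card {e \<in> incident v i. b e} = k} b)"
      unfolding of_nat_sum by (intro sum.cong) (auto simp: indicator_def)
    finally show ?thesis .
  qed
  then have "measure_pmf.expectation (graph_given n \<kappa> xs) (\<lambda>g. real (num_degree k g)) =
      measure_pmf.expectation ?q (\<lambda>b. \<Sum>i<v. indicator {b. card {e \<in> incident v i. b e} = k} b)"
    by (simp add: graph_given_eq_map num_degree_graph_of_indicator v_def p_def[abs_def])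
  also have "\<dots> = (\<Sum>i<v. measure ?q {b. card {e \<in> incident v i. b e} = k})"
    by (subst Bochner_Integration.integral_sum) (auto simp: finite_vertex_pairs)
  finally have "\<bar>measure_pmf.expectation (graph_given n \<kappa> xs) (\<lambda>g. real (num_degree k g)) -
      (\<Sum>i<v. poisson_weight k (sum p (incident v i)))\<bar> =
      \<bar>\<Sum>i<v. measure ?q {b. card {e \<in> incident v i. b e} = k} - poisson_weight k (sum p (incident v i))\<bar>"
    by (simp add: sum_subtractf)
  also have "\<dots> \<le> (\<Sum>i<v. 2 * (\<Sum>e\<in>incident v i. (p e)\<^sup>2))"
    by (intro sum_abs[THEN order_trans] sum_mono bern_field_subset_poisson_approximation)
      (auto simp: finite_vertex_pairs p_def edge_prob_bounds[OF assms] incident_def)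
  finally show ?thesis
    using sum_incident_edge_prob[OF assms(1), of _ xs "\<lambda>x. x" n]
      sum_incident_edge_prob[OF assms(1), of _ xs "\<lambda>x. x\<^sup>2" n]
    by (simp add: p_def v_def sum_distrib_left[symmetric] cong: sum.cong_simp)
qed

text \<open>Only the two endpoints of the toggled edge can change their degree.\<close>

lemma num_degree_toggle:
  assumes "e \<in> vertex_pairs v"
  shows "\<bar>real (num_degree k (graph_of_indicator v (b(e := True)))) -
    real (num_degree k (graph_of_indicator v (b(e := False))))\<bar> \<le> 2"
proof -
  define A where "A b = {i. i < v \<and> card {e \<in> incident v i. b e} = k}" for b
  have A: "card (A b) \<le> card (A b') + 2" if "\<And>e'. e' \<noteq> e \<Longrightarrow> b e' = b' e'" for b b'
  proof -
    have "A b \<subseteq> A b' \<union> {fst e, snd e}"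
    proof
      fix i assume i: "i \<in> A b"
      have "{e \<in> incident v i. b e} = {e \<in> incident v i. b' e}" if "i \<noteq> fst e" "i \<noteq> snd e"
      proof -
        have "e \<notin> incident v i" using that by (auto simp: incident_def)
        then show ?thesis using \<open>\<And>e'. e' \<noteq> e \<Longrightarrow> b e' = b' e'\<close> by (metis (lifting))
      qed
      with i show "i \<in> A b' \<union> {fst e, snd e}"
        unfolding A_def by (cases "i = fst e \<or> i = snd e") auto
    qed
    then have "card (A b) \<le> card (A b' \<union> {fst e, snd e})"
      by (intro card_mono) (auto simp: A_def)
    also have "\<dots> \<le> card (A b') + card {fst e, snd e}" by (rule card_Un_le)
    also have "\<dots> \<le> card (A b') + 2" by (simp add: card_insert_if)
    finally show ?thesis .
  qed
  have "card (A (b(e := True))) \<le> card (A (b(e := False))) + 2"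
    "card (A (b(e := False))) \<le> card (A (b(e := True))) + 2"
    by (rule A; simp)+
  then show ?thesis
    unfolding num_degree_graph_of_indicator A_def by linarith
qed

text \<open>Chebyshev's inequality with the variance bound for \<open>C = 2\<close>: four times the
  expected number of edges, which is \<open>n * scaled_degree_sum n \<kappa> xs / 2\<close>.\<close>

lemma num_degree_concentration:
  assumes "is_kernel \<kappa>" "0 < n" "0 < a"
  shows "measure (graph_given n \<kappa> xs) {g. a \<le> \<bar>real (num_degree k g) -
      measure_pmf.expectation (graph_given n \<kappa> xs) (\<lambda>g. real (num_degree k g))\<bar>}
    \<le> 2 * n * scaled_degree_sum n \<kappa> xs / a\<^sup>2"
proof -
  have "measure (bern_field (vertex_pairs (length xs)) (\<lambda>e. edge_prob n \<kappa> xs (fst e) (snd e)))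
      {b. a \<le> \<bar>real (num_degree k (graph_of_indicator (length xs) b)) -
        measure_pmf.expectation (bern_field (vertex_pairs (length xs)) (\<lambda>e. edge_prob n \<kappa> xs (fst e) (snd e)))
          (\<lambda>b. real (num_degree k (graph_of_indicator (length xs) b)))\<bar>}
    \<le> 2\<^sup>2 * (\<Sum>e\<in>vertex_pairs (length xs). edge_prob n \<kappa> xs (fst e) (snd e)) / a\<^sup>2"
    by (intro bern_field_deviation_le finite_vertex_pairs num_degree_toggle edge_prob_bounds assms)
  then show ?thesis
    by (simp add: graph_given_eq_map sum_edge_prob[OF assms(1,2)] vimage_def mult.assoc)
qed

text \<open>Here \<open>L i j / n\<close> is a minorant of the edge probabilities, so the total
  absolute error of the replacement is a difference of sums, measured by \<open>D\<close>. The terms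
  with \<open>m * v / n\<^sup>2\<close> account for the diagonal entries \<open>L i i\<close>, which
  enter the double sum but correspond to no possible edge.\<close>

lemma expectation_num_degree_minorant:
  fixes L :: "nat \<Rightarrow> nat \<Rightarrow> real" and xs :: "'a::topological_space list"
  defines "v \<equiv> length xs"
  assumes \<kappa>: "is_kernel \<kappa>" and n: "0 < n" and m: "0 \<le> m" "m \<le> n"
    and L0: "\<And>i j. 0 \<le> L i j" and Lm: "\<And>i j. L i j \<le> m" and L\<kappa>: "\<And>i j. L i j \<le> \<kappa> (xs ! i) (xs ! j)"
  shows "0 \<le> scaled_degree_sum n \<kappa> xs - (\<Sum>i<v. \<Sum>j<v. L i j) / n\<^sup>2 + m * v / n\<^sup>2"
    and "\<bar>measure_pmf.expectation (graph_given n \<kappa> xs) (\<lambda>g. real (num_degree k g)) / n -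
        (\<Sum>i<v. poisson_weight k ((\<Sum>j<v. L i j) / n)) / n\<bar>
      \<le> 3 * (scaled_degree_sum n \<kappa> xs - (\<Sum>i<v. \<Sum>j<v. L i j) / n\<^sup>2) +
        2 * (m / n) * scaled_degree_sum n \<kappa> xs + 4 * (m * v / n\<^sup>2)"
proof -
  define p where "p = edge_prob n \<kappa> xs"
  define d where "d i = (\<Sum>j\<in>{..<v} - {i}. p i j - L i j / n)" for i
  define D where "D = (\<Sum>i<v. d i) / n"
  let ?S = "scaled_degree_sum n \<kappa> xs"
  let ?Q = "(\<Sum>i<v. \<Sum>j<v. L i j) / n\<^sup>2"
  have p: "0 \<le> p i j" "p i j \<le> 1" for i j
    using edge_prob_bounds[OF \<kappa> n] by (auto simp: p_def)
  have S: "?S = (\<Sum>i<v. \<Sum>j\<in>{..<v} - {i}. p i j) / n"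
    by (simp add: scaled_degree_sum_def p_def v_def)
  \<comment> \<open>The bounds \<open>L i j \<le> m\<close> and \<open>m \<le> n\<close> keep
    \<open>L i j / n\<close> below the truncation of the edge probabilities at 1.\<close>
  have Lp: "L i j / n \<le> p i j" for i j
  proof -
    have "L i j / n \<le> \<kappa> (xs ! i) (xs ! j) / n" using L\<kappa> n by (intro divide_right_mono) auto
    moreover have "L i j / n \<le> 1" using Lm[of i j] m n by simp
    ultimately show ?thesis by (simp add: p_def edge_prob_def)
  qed
  then have d0: "0 \<le> d i" for i unfolding d_def by (intro sum_nonneg) auto
  have D0: "0 \<le> D" unfolding D_def using d0 n by (intro divide_nonneg_pos sum_nonneg) auto
  have rem: "(\<Sum>j<v. L i j) = L i i + (\<Sum>j\<in>{..<v} - {i}. L i j)" if "i < v" for i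
    using that by (subst sum.remove[of _ i]) auto
  have d: "d i = (\<Sum>j\<in>{..<v} - {i}. p i j) - (\<Sum>j<v. L i j) / n + L i i / n" if "i < v" for i
    unfolding d_def rem[OF that] by (simp add: sum_subtractf sum_divide_distrib add_divide_distrib)
  have "(\<Sum>i<v. d i) = (\<Sum>i<v. \<Sum>j\<in>{..<v} - {i}. p i j) - (\<Sum>i<v. \<Sum>j<v. L i j) / n + (\<Sum>i<v. L i i) / n"
    by (simp add: d sum.distrib sum_subtractf sum_divide_distrib cong: sum.cong_simp)
  then have Deq: "D = ?S - ?Q + (\<Sum>i<v. L i i) / n\<^sup>2"
    using n by (simp add: D_def S field_simps power2_eq_square)
  have "(\<Sum>i<v. L i i) / n\<^sup>2 \<le> m * v / n\<^sup>2"
    using sum_bounded_above[of "{..<v}" "\<lambda>i. L i i" m] Lm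
    by (intro divide_right_mono) (auto simp: mult.commute)
  with Deq have DS: "D \<le> ?S - ?Q + m * v / n\<^sup>2" by simp
  with D0 show "0 \<le> ?S - ?Q + m * v / n\<^sup>2" by simp
  \<comment> \<open>One factor \<open>p i j\<close> is split into the excess over
    \<open>L i j / n\<close>, which is then multiplied by a number at most 1, and
    \<open>L i j / n\<close> itself, which is at most \<open>m / n\<close>. Large edge probabilities
    are thus charged to the excess.\<close>
  have "(p i j)\<^sup>2 \<le> (p i j - L i j / n) + (m / n) * p i j" for i j
  proof -
    have "p i j * (p i j - L i j / n) \<le> 1 * (p i j - L i j / n)"
      using p Lp by (intro mult_right_mono) auto
    moreover have "(L i j / n) * p i j \<le> (m / n) * p i j"
      using p Lm n by (intro mult_right_mono divide_right_mono) auto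
    ultimately show ?thesis by (simp add: power2_eq_square algebra_simps)
  qed
  then have "(\<Sum>i<v. \<Sum>j\<in>{..<v} - {i}. (p i j)\<^sup>2) \<le>
      (\<Sum>i<v. \<Sum>j\<in>{..<v} - {i}. (p i j - L i j / n) + (m / n) * p i j)"
    by (intro sum_mono)
  also have "\<dots> = (\<Sum>i<v. d i) + (m / n) * (\<Sum>i<v. \<Sum>j\<in>{..<v} - {i}. p i j)"
    by (simp add: d_def sum.distrib sum_distrib_left)
  finally have "(\<Sum>i<v. \<Sum>j\<in>{..<v} - {i}. (p i j)\<^sup>2) / n \<le>
      ((\<Sum>i<v. d i) + (m / n) * (\<Sum>i<v. \<Sum>j\<in>{..<v} - {i}. p i j)) / n"
    using n by (intro divide_right_mono) auto
  then have sq: "(\<Sum>i<v. \<Sum>j\<in>{..<v} - {i}. (p i j)\<^sup>2) / n \<le> D + (m / n) * ?S"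
    by (simp add: D_def S add_divide_distrib)
  have "\<bar>poisson_weight k (\<Sum>j\<in>{..<v} - {i}. p i j) - poisson_weight k ((\<Sum>j<v. L i j) / n)\<bar> \<le> d i + m / n"
    if "i < v" for i
  proof -
    have "\<bar>poisson_weight k (\<Sum>j\<in>{..<v} - {i}. p i j) - poisson_weight k ((\<Sum>j<v. L i j) / n)\<bar> \<le>
        \<bar>(\<Sum>j\<in>{..<v} - {i}. p i j) - (\<Sum>j<v. L i j) / n\<bar>"
      using n L0 p by (intro poisson_weight_lipschitz sum_nonneg divide_nonneg_pos) auto
    also have "\<dots> \<le> d i + L i i / n"
      using d[OF that] d0[of i] divide_nonneg_pos[OF L0 n, of i i] by linarith
    also have "\<dots> \<le> d i + m / n"
      using Lm n by (simp add: divide_right_mono)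
    finally show ?thesis .
  qed
  then have "\<bar>(\<Sum>i<v. poisson_weight k (\<Sum>j\<in>{..<v} - {i}. p i j)) -
      (\<Sum>i<v. poisson_weight k ((\<Sum>j<v. L i j) / n))\<bar> \<le> (\<Sum>i<v. d i + m / n)"
    unfolding sum_subtractf[symmetric] by (intro sum_abs[THEN order_trans] sum_mono) auto
  then have "\<bar>(\<Sum>i<v. poisson_weight k (\<Sum>j\<in>{..<v} - {i}. p i j)) -
      (\<Sum>i<v. poisson_weight k ((\<Sum>j<v. L i j) / n))\<bar> / n \<le> (\<Sum>i<v. d i + m / n) / n"
    using n by (intro divide_right_mono) auto
  also have "\<dots> = D + m * v / n\<^sup>2"
    using n by (simp add: D_def sum.distrib add_divide_distrib power2_eq_square mult.commute)
  finally have pw: "\<bar>(\<Sum>i<v. poisson_weight k (\<Sum>j\<in>{..<v} - {i}. p i j)) / n -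
      (\<Sum>i<v. poisson_weight k ((\<Sum>j<v. L i j) / n)) / n\<bar> \<le> D + m * v / n\<^sup>2"
    using n by (simp add: abs_divide flip: diff_divide_distrib)
  let ?E = "measure_pmf.expectation (graph_given n \<kappa> xs) (\<lambda>g. real (num_degree k g))"
  have "\<bar>?E - (\<Sum>i<v. poisson_weight k (\<Sum>j\<in>{..<v} - {i}. p i j))\<bar> / n \<le>
      2 * (\<Sum>i<v. \<Sum>j\<in>{..<v} - {i}. (p i j)\<^sup>2) / n"
    using expectation_num_degree[OF \<kappa> n, of xs k] n by (intro divide_right_mono) (auto simp: p_def v_def)
  then have E: "\<bar>?E / n - (\<Sum>i<v. poisson_weight k (\<Sum>j\<in>{..<v} - {i}. p i j)) / n\<bar> \<le>
      2 * ((\<Sum>i<v. \<Sum>j\<in>{..<v} - {i}. (p i j)\<^sup>2) / n)"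
    using n by (simp add: abs_divide flip: diff_divide_distrib)
  \<comment> \<open>Two copies of \<open>D\<close> come from Le Cam's inequality and one from the
    Lipschitz bound; replacing each by \<open>u + w\<close> adds three copies of \<open>w\<close> to
    the one already present.\<close>
  have "\<bar>e - g\<bar> \<le> 3 * u + 2 * t + 4 * w"
    if "\<bar>e - f\<bar> \<le> 2 * s" "s \<le> D + t" "\<bar>f - g\<bar> \<le> D + w" "D \<le> u + w" for e f g s t u w :: real
    using that by linarith
  from this[OF E sq pw DS]
  show "\<bar>?E / n - (\<Sum>i<v. poisson_weight k ((\<Sum>j<v. L i j) / n)) / n\<bar> \<le>
      3 * (?S - ?Q) + 2 * (m / n) * ?S + 4 * (m * v / n\<^sup>2)"
    by (simp only: mult.assoc)
qed

section \<open>Frequencies of the types among the points\<close>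

definition type_freq :: "('a \<Rightarrow> 'b) \<Rightarrow> real \<Rightarrow> 'a list \<Rightarrow> 'b \<Rightarrow> real" where
  "type_freq \<tau> n xs a = real (card {i. i < length xs \<and> xs ! i \<in> {x. \<tau> x = a}}) / n"

lemma sum_type_freq:
  fixes F :: "'b \<Rightarrow> real"
  assumes "finite (range \<tau>)"
  shows "(\<Sum>i<length xs. F (\<tau> (xs ! i))) / n = (\<Sum>a\<in>range \<tau>. F a * type_freq \<tau> n xs a)"
proof -
  have "(\<Sum>i<length xs. F (\<tau> (xs ! i))) =
      (\<Sum>i<length xs. \<Sum>a\<in>range \<tau>. F a * indicator {x. \<tau> x = a} (xs ! i))"
    by (simp add: sum_indicator_fibre[OF assms])
  also have "\<dots> = (\<Sum>a\<in>range \<tau>. F a * (\<Sum>i<length xs. indicator {x. \<tau> x = a} (xs ! i)))"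
    by (subst sum.swap) (simp add: sum_distrib_left)
  also have "\<dots> = (\<Sum>a\<in>range \<tau>. F a * real (card {i. i < length xs \<and> xs ! i \<in> {x. \<tau> x = a}}))"
  proof (intro sum.cong refl arg_cong[where f = "(*) _"])
    fix a
    have "(\<Sum>i<length xs. indicator {x. \<tau> x = a} (xs ! i) :: real) =
        (\<Sum>i<length xs. if xs ! i \<in> {x. \<tau> x = a} then 1 else 0)"
      by (intro sum.cong) (auto simp: indicator_def)
    then show "(\<Sum>i<length xs. indicator {x. \<tau> x = a} (xs ! i)) =
        real (card {i. i < length xs \<and> xs ! i \<in> {x. \<tau> x = a}})"
      by (simp add: sum.If_cases Int_def)
  qed
  finally show ?thesis by (simp add: type_freq_def sum_divide_distrib)
qed

text \<open>If each \<open>inverse (real (Suc j))\<close> failed as \<open>d\<close>, the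
  counterexamples would form a sequence converging to \<open>u\<close> in every coordinate of
  \<open>T\<close>, against the sequential continuity of \<open>\<Phi>\<close> at
  \<open>u\<close>.\<close>

lemma finite_coordinates_eps_delta:
  fixes \<Phi> :: "('b \<Rightarrow> real) \<Rightarrow> real"
  assumes seq: "\<And>U. (\<And>a. a \<in> T \<Longrightarrow> (\<lambda>j. U j a) \<longlonglongrightarrow> u a) \<Longrightarrow> (\<lambda>j. \<Phi> (U j)) \<longlonglongrightarrow> \<Phi> u"
    and e: "0 < e"
  shows "\<exists>d>0. \<forall>w. (\<forall>a\<in>T. \<bar>w a - u a\<bar> \<le> d) \<longrightarrow> \<bar>\<Phi> w - \<Phi> u\<bar> < e"
proof (rule ccontr)
  assume "\<not> ?thesis"
  then have "\<forall>j. \<exists>w. (\<forall>a\<in>T. \<bar>w a - u a\<bar> \<le> inverse (real (Suc j))) \<and> e \<le> \<bar>\<Phi> w - \<Phi> u\<bar>"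
    by (metis inverse_positive_iff_positive linorder_not_le of_nat_0_less_iff zero_less_Suc)
  then obtain U where U: "\<And>j a. a \<in> T \<Longrightarrow> \<bar>U j a - u a\<bar> \<le> inverse (real (Suc j))"
      "\<And>j. e \<le> \<bar>\<Phi> (U j) - \<Phi> u\<bar>"
    unfolding choice_iff by blast
  have "(\<lambda>j. U j a) \<longlonglongrightarrow> u a" if "a \<in> T" for a
  proof -
    have "(\<lambda>j. U j a - u a) \<longlonglongrightarrow> 0"
      using U(1)[OF that] by (intro Lim_null_comparison[OF _ LIMSEQ_inverse_real_of_nat]) auto
    then show ?thesis by (simp add: LIM_zero_iff)
  qed
  then have "(\<lambda>j. \<Phi> (U j)) \<longlonglongrightarrow> \<Phi> u" by (rule seq)
  from LIMSEQ_D[OF this e] U(2) show False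
    by (metis linorder_not_le order_refl real_norm_def)
qed

text \<open>The count is a sum of indicators with a random number of terms, handled by composing
  with the countably valued length. An entry is measurable only where it exists, so existence is
  part of each event.\<close>

lemma random_list_count_measurable:
  fixes Y :: "'w \<Rightarrow> 'a::topological_space list"
  assumes Y: "random_list Q Y" and A: "A \<in> sets borel"
  shows "(\<lambda>\<omega>. real (card {i. i < length (Y \<omega>) \<and> Y \<omega> ! i \<in> A})) \<in> borel_measurable Q"
proof -
  have len: "(\<lambda>\<omega>. length (Y \<omega>)) \<in> measurable Q (count_space UNIV)"
    using Y by (simp add: random_list_def)
  have S: "{\<omega> \<in> space Q. i < length (Y \<omega>) \<and> Y \<omega> ! i \<in> A} \<in> sets Q" for i
  proof -
    let ?S = "{\<omega> \<in> space Q. i < length (Y \<omega>)}"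
    have "(\<lambda>\<omega>. length (Y \<omega>)) -` {i<..} \<inter> space Q \<in> sets Q"
      by (rule measurable_sets[OF len]) simp
    moreover have "(\<lambda>\<omega>. length (Y \<omega>)) -` {i<..} \<inter> space Q = ?S" by auto
    ultimately have S: "?S \<in> sets Q" by simp
    have "(\<lambda>\<omega>. Y \<omega> ! i) \<in> borel_measurable (restrict_space Q ?S)"
      using Y by (simp add: random_list_def)
    from measurable_sets[OF this A]
    have "(\<lambda>\<omega>. Y \<omega> ! i) -` A \<inter> ?S \<in> sets (restrict_space Q ?S)"
      by (simp add: space_restrict_space Int_def conj_ac)
    then have "(\<lambda>\<omega>. Y \<omega> ! i) -` A \<inter> ?S \<in> sets Q"
      using S by (subst (asm) sets_restrict_space_iff) auto
    moreover have "(\<lambda>\<omega>. Y \<omega> ! i) -` A \<inter> ?S = {\<omega> \<in> space Q. i < length (Y \<omega>) \<and> Y \<omega> ! i \<in> A}"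
      by auto
    ultimately show ?thesis by simp
  qed
  have "(\<lambda>\<omega>. (\<lambda>v \<omega>. \<Sum>i<v. indicator {\<omega> \<in> space Q. i < length (Y \<omega>) \<and> Y \<omega> ! i \<in> A} \<omega> :: real)
      (length (Y \<omega>)) \<omega>) \<in> borel_measurable Q"
    by (rule measurable_compose_countable[OF _ len])
      (intro borel_measurable_sum borel_measurable_indicator S)
  then show ?thesis
  proof (rule measurable_cong[THEN iffD1, rotated])
    fix \<omega> assume "\<omega> \<in> space Q"
    then have "(\<Sum>i<length (Y \<omega>). indicator {\<omega> \<in> space Q. i < length (Y \<omega>) \<and> Y \<omega> ! i \<in> A} \<omega> :: real) =
        (\<Sum>i<length (Y \<omega>). if Y \<omega> ! i \<in> A then 1 else 0)"
      by (intro sum.cong) (auto simp: indicator_def)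
    then show "(\<Sum>i<length (Y \<omega>). indicator {\<omega> \<in> space Q. i < length (Y \<omega>) \<and> Y \<omega> ! i \<in> A} \<omega> :: real) =
        real (card {i. i < length (Y \<omega>) \<and> Y \<omega> ! i \<in> A})"
      by (simp add: sum.If_cases Int_def)
  qed
qed

subsection \<open>Mixed Poisson integrals and convergence in probability\<close>

lemma borel_measurable_poisson_weight [measurable]: "poisson_weight k \<in> borel_measurable borel"
  unfolding poisson_weight_def[abs_def] by measurable

lemma (in finite_measure) integrable_poisson_weight:
  assumes "f \<in> borel_measurable M" "\<And>x. 0 \<le> f x"
  shows "integrable M (\<lambda>x. poisson_weight k (f x))"
  using assms poisson_weight_nonneg poisson_weight_le_1
  by (intro integrable_const_bound[where B = 1] measurable_compose[OF assms(1)]) auto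

text \<open>The Poisson weight is 1-Lipschitz and the partial integrals of \<open>f\<close> and
  \<open>g\<close> are ordered almost everywhere, so the pointwise error integrates to the
  difference of the double integrals. It is applied to the step minorant and the limit
  kernel.\<close>

lemma poisson_mixture_diff_le:
  fixes f g :: "'a \<times> 'a \<Rightarrow> real"
  assumes "finite_measure M"
    and f: "integrable (M \<Otimes>\<^sub>M M) f" and g: "integrable (M \<Otimes>\<^sub>M M) g"
    and f0: "\<And>p. 0 \<le> f p" and g0: "\<And>p. 0 \<le> g p"
    and fg: "AE p in M \<Otimes>\<^sub>M M. f p \<le> g p"
  shows "\<bar>(\<integral>x. poisson_weight k (\<integral>y. f (x, y) \<partial>M) \<partial>M) - (\<integral>x. poisson_weight k (\<integral>y. g (x, y) \<partial>M) \<partial>M)\<bar>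
    \<le> integral\<^sup>L (M \<Otimes>\<^sub>M M) g - integral\<^sup>L (M \<Otimes>\<^sub>M M) f"
proof -
  interpret M: finite_measure M by fact
  interpret pair_sigma_finite M M by unfold_locales
  define F where "F x = (\<integral>y. f (x, y) \<partial>M)" for x
  define G where "G x = (\<integral>y. g (x, y) \<partial>M)" for x
  have intF: "integrable M F" and intG: "integrable M G"
    unfolding F_def G_def by (intro integrable_fst' f g)+
  have F0: "0 \<le> F x" and G0: "0 \<le> G x" for x
    unfolding F_def G_def using f0 g0 by auto
  have "AE x in M. AE y in M. f (x, y) \<le> g (x, y)"
    using AE_pair[OF fg] by simp
  then have FG: "AE x in M. F x \<le> G x"
    using AE_integrable_fst'[OF f] AE_integrable_fst'[OF g]
    by eventually_elim (auto simp: F_def G_def intro!: integral_mono_AE)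
  have pw: "integrable M (\<lambda>x. poisson_weight k (F x))" "integrable M (\<lambda>x. poisson_weight k (G x))"
    using intF intG F0 G0 by (auto intro!: M.integrable_poisson_weight)
  have "\<bar>(\<integral>x. poisson_weight k (F x) \<partial>M) - (\<integral>x. poisson_weight k (G x) \<partial>M)\<bar> =
      \<bar>\<integral>x. poisson_weight k (F x) - poisson_weight k (G x) \<partial>M\<bar>"
    by (simp add: pw)
  also have "\<dots> \<le> (\<integral>x. \<bar>poisson_weight k (F x) - poisson_weight k (G x)\<bar> \<partial>M)"
    by (rule integral_abs_bound)
  also have "\<dots> \<le> (\<integral>x. G x - F x \<partial>M)"
  proof (rule integral_mono_AE)
    show "AE x in M. \<bar>poisson_weight k (F x) - poisson_weight k (G x)\<bar> \<le> G x - F x"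
      using FG
    proof eventually_elim
      case (elim x)
      then show ?case using poisson_weight_lipschitz[OF F0 G0, of k x x] by linarith
    qed
  qed (use pw intF intG in auto)
  also have "\<dots> = integral\<^sup>L (M \<Otimes>\<^sub>M M) g - integral\<^sup>L (M \<Otimes>\<^sub>M M) f"
    unfolding Bochner_Integration.integral_diff[OF intG intF]
    using integral_fst'[OF f] integral_fst'[OF g] by (simp add: F_def[abs_def] G_def[abs_def])
  finally show ?thesis by (simp add: F_def G_def)
qed

lemma (in finite_measure) integral_step_function:
  fixes F :: "'b \<Rightarrow> real"
  assumes "finite (range \<tau>)" "\<And>a. {x. \<tau> x = a} \<in> sets M"
  shows "(\<integral>x. F (\<tau> x) \<partial>M) = (\<Sum>a\<in>range \<tau>. F a * measure M {x. \<tau> x = a})"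
    and "integrable M (\<lambda>x. F (\<tau> x))"
proof -
  have eq: "F (\<tau> x) = (\<Sum>a\<in>range \<tau>. F a * indicator {x. \<tau> x = a} x)" for x
    by (simp add: sum_indicator_fibre[OF assms(1)])
  have int: "integrable M (indicator {x. \<tau> x = a} :: _ \<Rightarrow> real)" for a
    using assms(2) by (intro integrable_real_indicator) (auto simp: emeasure_eq_measure)
  have m: "(\<integral>x. indicator {x. \<tau> x = a} x \<partial>M) = measure M {x. \<tau> x = a}" for a
    using sets.sets_into_space[OF assms(2)[of a]]
    by (simp add: Int_absorb2)
  show "(\<integral>x. F (\<tau> x) \<partial>M) = (\<Sum>a\<in>range \<tau>. F a * measure M {x. \<tau> x = a})"
    unfolding eq by (subst Bochner_Integration.integral_sum)
      (auto simp: int m simp del: Bochner_Integration.integral_indicator)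
  show "integrable M (\<lambda>x. F (\<tau> x))"
    unfolding eq by (intro Bochner_Integration.integrable_sum integrable_mult_right int)
qed

section \<open>Limits along the index set and quotients in probability\<close>

lemma at_top_in_le: "at_top_in I \<le> at_top"
  by (simp add: at_top_in_def)

lemma eventually_at_top_in_ge: "eventually (\<lambda>n. n \<in> I \<and> c \<le> n) (at_top_in I)"
  unfolding eventually_at_top_in by blast

lemma tendsto_const_div_at_top_in: "((\<lambda>n. c / n) \<longlongrightarrow> (0::real)) (at_top_in I)"
  by (rule tendsto_mono[OF at_top_in_le])
    (rule tendsto_divide_0[OF tendsto_const filterlim_at_top_imp_at_infinity[OF filterlim_ident]])

lemma tendsto_in_prob_cong:
  assumes "eventually (\<lambda>n. Y n = Z n) F" "tendsto_in_prob Q Y c F"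
  shows "tendsto_in_prob Q Z c F"
  unfolding tendsto_in_prob_def
proof (intro allI impI)
  fix \<epsilon> :: real assume "0 < \<epsilon>"
  with assms(2) have "((\<lambda>n. measure (Q n) {\<omega> \<in> space (Q n). \<epsilon> < \<bar>Y n \<omega> - c\<bar>}) \<longlongrightarrow> 0) F"
    by (simp add: tendsto_in_prob_def)
  then show "((\<lambda>n. measure (Q n) {\<omega> \<in> space (Q n). \<epsilon> < \<bar>Z n \<omega> - c\<bar>}) \<longlongrightarrow> 0) F"
    by (rule Lim_transform_eventually) (use assms(1) in eventually_elim, simp)
qed

text \<open>A deterministic estimate holds as soon as both \<open>Y\<close> and \<open>Z\<close> are
  within \<open>\<delta>\<close> of their limits, and a union bound does the rest. Having every set
  measurable, as for the random graph laws, settles the measurability of the events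
  involved.\<close>

lemma tendsto_in_prob_divide:
  assumes Q: "eventually (\<lambda>n. finite_measure (Q n) \<and> sets (Q n) = UNIV) F"
    and Y: "tendsto_in_prob Q Y c F" and Z: "tendsto_in_prob Q Z M F"
    and c: "0 \<le> c" and M: "0 < M"
  shows "tendsto_in_prob Q (\<lambda>n \<omega>. Y n \<omega> / Z n \<omega>) (c / M) F"
  unfolding tendsto_in_prob_def
proof (intro allI impI)
  fix \<epsilon> :: real assume \<epsilon>: "0 < \<epsilon>"
  \<comment> \<open>The first bound keeps the denominator at least \<open>M / 2\<close>; the second
    makes the numerator of the difference of quotients at most
    \<open>\<epsilon> * (M * (M / 2))\<close>.\<close>
  define \<delta> where "\<delta> = min (M / 2) (\<epsilon> * M\<^sup>2 / (2 * (M + c)))"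
  have \<delta>: "0 < \<delta>" using \<epsilon> M c by (simp add: \<delta>_def)
  have lim: "((\<lambda>n. measure (Q n) {\<omega> \<in> space (Q n). \<bar>Y n \<omega> - c\<bar> > \<delta>} +
      measure (Q n) {\<omega> \<in> space (Q n). \<bar>Z n \<omega> - M\<bar> > \<delta>}) \<longlongrightarrow> 0) F"
    using Y Z \<delta> unfolding tendsto_in_prob_def by (intro tendsto_add_zero) auto
  have close: "\<bar>y / z - c / M\<bar> \<le> \<epsilon>" if "\<bar>y - c\<bar> \<le> \<delta>" "\<bar>z - M\<bar> \<le> \<delta>" for y z :: real
  proof -
    have "\<delta> \<le> M / 2" unfolding \<delta>_def by (rule min.cobounded1)
    then have z: "M / 2 \<le> z" using that(2) by linarith
    then have z0: "0 < z" using M by simp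
    have "\<bar>M * (y - c) - c * (z - M)\<bar> \<le> M * \<delta> + c * \<delta>"
    proof -
      have "\<bar>M * (y - c)\<bar> \<le> M * \<delta>" "\<bar>c * (z - M)\<bar> \<le> c * \<delta>"
        using that M c by (auto simp: abs_mult intro!: mult_left_mono)
      then show ?thesis by linarith
    qed
    also have "\<dots> = (M + c) * \<delta>" by (simp add: algebra_simps)
    also have "\<dots> \<le> (M + c) * (\<epsilon> * M\<^sup>2 / (2 * (M + c)))"
      using M c by (intro mult_left_mono) (auto simp: \<delta>_def)
    also have "(M + c) * (\<epsilon> * M\<^sup>2 / (2 * (M + c))) = \<epsilon> * (M * (M / 2))"
    proof -
      have "q * (a / (2 * q)) = a / 2" if "0 < q" for q a :: real
        using that by simp
      from this[of "M + c" "\<epsilon> * M\<^sup>2"] show ?thesis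
        using M c by (simp add: power2_eq_square)
    qed
    also have "\<dots> \<le> \<epsilon> * (M * z)" using z M \<epsilon> by (intro mult_left_mono) auto
    finally have le: "\<bar>M * (y - c) - c * (z - M)\<bar> \<le> \<epsilon> * (M * z)" .
    have "y / z - c / M = (M * (y - c) - c * (z - M)) / (M * z)"
      using z0 M by (simp add: field_simps)
    then have "\<bar>y / z - c / M\<bar> = \<bar>M * (y - c) - c * (z - M)\<bar> / (M * z)"
      using z0 M by (simp add: abs_divide)
    also have "\<dots> \<le> \<epsilon>" using le z0 M by (simp add: pos_divide_le_eq)
    finally show ?thesis .
  qed
  show "((\<lambda>n. measure (Q n) {\<omega> \<in> space (Q n). \<epsilon> < \<bar>Y n \<omega> / Z n \<omega> - c / M\<bar>}) \<longlongrightarrow> 0) F"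
  proof (rule tendsto_sandwich[OF _ _ tendsto_const lim])
    show "eventually (\<lambda>n. 0 \<le> measure (Q n) {\<omega> \<in> space (Q n). \<epsilon> < \<bar>Y n \<omega> / Z n \<omega> - c / M\<bar>}) F"
      by simp
    show "eventually (\<lambda>n. measure (Q n) {\<omega> \<in> space (Q n). \<epsilon> < \<bar>Y n \<omega> / Z n \<omega> - c / M\<bar>} \<le>
        measure (Q n) {\<omega> \<in> space (Q n). \<bar>Y n \<omega> - c\<bar> > \<delta>} +
        measure (Q n) {\<omega> \<in> space (Q n). \<bar>Z n \<omega> - M\<bar> > \<delta>}) F"
      using Q
    proof eventually_elim
      case (elim n)
      then interpret finite_measure "Q n" by simp
      have "measure (Q n) {\<omega> \<in> space (Q n). \<epsilon> < \<bar>Y n \<omega> / Z n \<omega> - c / M\<bar>} \<le>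
          measure (Q n) ({\<omega> \<in> space (Q n). \<bar>Y n \<omega> - c\<bar> > \<delta>} \<union> {\<omega> \<in> space (Q n). \<bar>Z n \<omega> - M\<bar> > \<delta>})"
        using elim close by (intro finite_measure_mono) (auto simp: not_le[symmetric])
      also have "\<dots> \<le> measure (Q n) {\<omega> \<in> space (Q n). \<bar>Y n \<omega> - c\<bar> > \<delta>} +
          measure (Q n) {\<omega> \<in> space (Q n). \<bar>Z n \<omega> - M\<bar> > \<delta>}"
        using elim by (intro measure_Un_le) auto
      finally show ?case .
    qed
  qed
qed

subsection \<open>Degrees in the random graph\<close>

lemma scaled_degree_sum_nonneg:
  "is_kernel \<kappa> \<Longrightarrow> 0 < n \<Longrightarrow> 0 \<le> scaled_degree_sum n \<kappa> xs"
  unfolding scaled_degree_sum_def by (intro divide_nonneg_pos sum_nonneg edge_prob_bounds)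

context generalized_vertex_space
begin

lemma index_gt_0: "n \<in> I \<Longrightarrow> 0 < n"
  using index_pos by auto

lemma space_mu [simp]: "space \<mu> = UNIV"
  using sets_eq_imp_space_eq[OF sets_mu] by simp

lemma eventually_index: "eventually (\<lambda>n. n \<in> I) (at_top_in I)"
  unfolding eventually_at_top_in by blast

context
  fixes n :: real and \<kappa>' :: "'a \<Rightarrow> 'a \<Rightarrow> real"
  assumes n: "n \<in> I" and \<kappa>': "is_kernel \<kappa>'"
begin

lemma space_random_graph: "space (random_graph P X n \<kappa>') = UNIV"
  using prob_space_random_graph(2)[where P = P and X = X,
      OF prob_space_P[OF n] random_list_X[OF n] \<kappa>' index_gt_0[OF n]]
  by (metis sets.top sets_eq_imp_space_eq UNIV_I sets.sets_into_space top.extremum_uniqueI)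

text \<open>The law of the graph is a mixture of its conditional laws, so bounds on conditional
  probabilities integrate. This is the passage from given points to random points.\<close>

lemma measure_random_graph_le:
  assumes f: "integrable (P n) f"
    and le: "\<And>\<omega>. \<omega> \<in> space (P n) \<Longrightarrow> measure (graph_given n \<kappa>' (X n \<omega>)) A \<le> f \<omega>"
  shows "measure (random_graph P X n \<kappa>') A \<le> integral\<^sup>L (P n) f"
proof -
  note R = prob_space_random_graph[where P = P and X = X,
      OF prob_space_P[OF n] random_list_X[OF n] \<kappa>' index_gt_0[OF n]]
  interpret R: prob_space "random_graph P X n \<kappa>'" by (rule R(1))
  have f0: "0 \<le> f \<omega>" if "\<omega> \<in> space (P n)" for \<omega>
    using le[OF that] measure_nonneg order_trans by blast
  have "ennreal (measure (random_graph P X n \<kappa>') A) =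
      (\<integral>\<^sup>+ \<omega>. emeasure (measure_pmf (graph_given n \<kappa>' (X n \<omega>))) A \<partial>P n)"
    by (simp add: R(3) flip: R.emeasure_eq_measure)
  also have "\<dots> \<le> (\<integral>\<^sup>+ \<omega>. ennreal (f \<omega>) \<partial>P n)"
    using le by (intro nn_integral_mono) (simp add: measure_pmf.emeasure_eq_measure ennreal_leI)
  also have "\<dots> = ennreal (integral\<^sup>L (P n) f)"
    using f f0 by (intro nn_integral_eq_integral) auto
  finally show ?thesis
    using f0 by (subst (asm) ennreal_le_iff) (auto intro: integral_nonneg)
qed

text \<open>Both claims come from the conditional expected number of edges, which depends measurably
  on the outcome because the conditional laws form a measurable kernel. Being nonnegative, the sum
  is recovered from it by \<open>enn2real\<close> and rescaling.\<close>

lemma scaled_degree_sum_measurable: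
  "(\<lambda>\<omega>. scaled_degree_sum n \<kappa>' (X n \<omega>)) \<in> borel_measurable (P n)"
    and nn_integral_scaled_degree_sum:
  "(\<integral>\<^sup>+ \<omega>. ennreal (scaled_degree_sum n \<kappa>' (X n \<omega>)) \<partial>P n) =
    2 * ((\<integral>\<^sup>+ g. of_nat (card (edges g)) \<partial>random_graph P X n \<kappa>') / ennreal n)"
proof -
  have n0: "0 < n" by (rule index_gt_0[OF n])
  note K = graph_given_measurable[OF random_list_X[OF n] \<kappa>' n0]
  note S0 = scaled_degree_sum_nonneg[OF \<kappa>' n0]
  define S where "S \<omega> = scaled_degree_sum n \<kappa>' (X n \<omega>)" for \<omega>
  interpret prob_space "P n" by (rule prob_space_P[OF n])
  have "(\<lambda>\<omega>. \<integral>\<^sup>+ g. of_nat (card (edges g)) \<partial>measure_pmf (graph_given n \<kappa>' (X n \<omega>)))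
      \<in> borel_measurable (P n)"
    by (rule measurable_compose[OF K nn_integral_measurable_subprob_algebra]) simp
  then have "(\<lambda>\<omega>. ennreal (n * S \<omega> / 2)) \<in> borel_measurable (P n)"
    unfolding nn_integral_card_edges_graph_given[OF \<kappa>' n0] S_def .
  then have "(\<lambda>\<omega>. enn2real (ennreal (n * S \<omega> / 2))) \<in> borel_measurable (P n)"
    by measurable
  then have "(\<lambda>\<omega>. 2 / n * enn2real (ennreal (n * S \<omega> / 2))) \<in> borel_measurable (P n)"
    by (rule borel_measurable_times[OF borel_measurable_const])
  then show meas: "(\<lambda>\<omega>. scaled_degree_sum n \<kappa>' (X n \<omega>)) \<in> borel_measurable (P n)"
    using n0 S0 by (simp add: S_def)
  have "(\<integral>\<^sup>+ g. of_nat (card (edges g)) \<partial>random_graph P X n \<kappa>') = (\<integral>\<^sup>+ \<omega>. ennreal (n * S \<omega> / 2) \<partial>P n)"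
    unfolding random_graph_def S_def nn_integral_card_edges_graph_given[OF \<kappa>' n0, symmetric]
    by (rule nn_integral_bind[OF _ K]) simp
  then have "(\<integral>\<^sup>+ g. of_nat (card (edges g)) \<partial>random_graph P X n \<kappa>') / ennreal n =
      (\<integral>\<^sup>+ \<omega>. ennreal (n * S \<omega> / 2) / ennreal n \<partial>P n)"
    using meas by (simp add: nn_integral_divide S_def)
  also have "\<dots> = (\<integral>\<^sup>+ \<omega>. ennreal (S \<omega> / 2) \<partial>P n)"
    using S0 n0 by (intro nn_integral_cong) (simp add: divide_ennreal S_def)
  finally have "2 * ((\<integral>\<^sup>+ g. of_nat (card (edges g)) \<partial>random_graph P X n \<kappa>') / ennreal n) =
      (\<integral>\<^sup>+ \<omega>. 2 * ennreal (S \<omega> / 2) \<partial>P n)"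
    using meas by (simp add: nn_integral_cmult S_def)
  moreover have "2 * ennreal (S \<omega> / 2) = ennreal (S \<omega>)" for \<omega>
    using ennreal_mult'[of 2 "S \<omega> / 2"] by simp
  ultimately show "(\<integral>\<^sup>+ \<omega>. ennreal (scaled_degree_sum n \<kappa>' (X n \<omega>)) \<partial>P n) =
      2 * ((\<integral>\<^sup>+ g. of_nat (card (edges g)) \<partial>random_graph P X n \<kappa>') / ennreal n)"
    by (simp add: S_def)
qed

end

text \<open>The factor 2 cancels the 1/2 in \<open>graphical\<close>. Integrability is only
  eventual: the extended limit is finite, hence so are the expectations of large index, and the
  limit then passes to the real integrals.\<close>

lemma expected_degree_sum_tendsto:
  assumes g: "graphical \<mu> I P X \<kappa>s \<kappa>"
  shows "eventually (\<lambda>n. integrable (P n) (\<lambda>\<omega>. scaled_degree_sum n (\<kappa>s n) (X n \<omega>))) (at_top_in I)"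
    and "((\<lambda>n. \<integral>\<omega>. scaled_degree_sum n (\<kappa>s n) (X n \<omega>) \<partial>P n) \<longlongrightarrow>
      (\<integral>p. case_prod \<kappa> p \<partial>(\<mu> \<Otimes>\<^sub>M \<mu>))) (at_top_in I)"
proof -
  let ?S = "\<lambda>n \<omega>. scaled_degree_sum n (\<kappa>s n) (X n \<omega>)"
  let ?c = "\<integral>p. case_prod \<kappa> p \<partial>(\<mu> \<Otimes>\<^sub>M \<mu>)"
  have ker: "is_kernel (\<kappa>s n)" if "n \<in> I" for n using g that by (simp add: graphical_def)
  have c0: "0 \<le> ?c"
    using g by (intro Bochner_Integration.integral_nonneg) (auto simp: graphical_def is_kernel_def)
  have "((\<lambda>n. (\<integral>\<^sup>+ g. of_nat (card (edges g)) \<partial>random_graph P X n (\<kappa>s n)) / ennreal n) \<longlongrightarrow>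
      ennreal (1 / 2 * ?c)) (at_top_in I)"
    using g by (simp add: graphical_def)
  then have "((\<lambda>n. 2 * ((\<integral>\<^sup>+ g. of_nat (card (edges g)) \<partial>random_graph P X n (\<kappa>s n)) / ennreal n)) \<longlongrightarrow>
      2 * ennreal (1 / 2 * ?c)) (at_top_in I)"
    by (intro ennreal_tendsto_cmult) auto
  also have "2 * ennreal (1 / 2 * ?c) = ennreal ?c"
    using c0 ennreal_mult'[of 2 "1 / 2 * ?c"] by simp
  finally have lim: "((\<lambda>n. \<integral>\<^sup>+ \<omega>. ennreal (?S n \<omega>) \<partial>P n) \<longlongrightarrow> ennreal ?c) (at_top_in I)"
    by (rule Lim_transform_eventually)
      (use eventually_index in eventually_elim, simp add: nn_integral_scaled_degree_sum ker)
  then have "eventually (\<lambda>n. (\<integral>\<^sup>+ \<omega>. ennreal (?S n \<omega>) \<partial>P n) < \<infinity>) (at_top_in I)"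
    by (rule order_tendstoD(2)) simp
  with eventually_index show int: "eventually (\<lambda>n. integrable (P n) (?S n)) (at_top_in I)"
    by eventually_elim
      (auto intro!: integrableI_nonneg scaled_degree_sum_measurable AE_I2 scaled_degree_sum_nonneg
        ker index_gt_0)
  have "((\<lambda>n. enn2real (\<integral>\<^sup>+ \<omega>. ennreal (?S n \<omega>) \<partial>P n)) \<longlongrightarrow> ?c) (at_top_in I)"
    by (rule tendsto_enn2real[OF lim]) (use c0 in auto)
  then show "((\<lambda>n. \<integral>\<omega>. ?S n \<omega> \<partial>P n) \<longlongrightarrow> ?c) (at_top_in I)"
    by (rule Lim_transform_eventually)
      (use eventually_index in eventually_elim,
        auto intro!: integral_eq_nn_integral[symmetric] scaled_degree_sum_measurable AE_I2
          scaled_degree_sum_nonneg ker index_gt_0)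
qed

lemma type_freq_measurable:
  assumes "n \<in> I" "continuity_set \<mu> {x. \<tau> x = a}"
  shows "(\<lambda>\<omega>. type_freq \<tau> n (X n \<omega>) a) \<in> borel_measurable (P n)"
  unfolding type_freq_def using assms
  by (intro borel_measurable_divide borel_measurable_const random_list_count_measurable random_list_X)
    (auto simp: continuity_set_def)

text \<open>A union bound over the finitely many types, each of which is a continuity set.\<close>

lemma type_freqs_deviate_tendsto_0:
  assumes fin: "finite (range \<tau>)" and cont: "\<And>a. continuity_set \<mu> {x. \<tau> x = a}" and \<delta>: "0 < \<delta>"
  shows "((\<lambda>n. measure (P n) {\<omega> \<in> space (P n). \<exists>a\<in>range \<tau>.
      \<bar>type_freq \<tau> n (X n \<omega>) a - measure \<mu> {x. \<tau> x = a}\<bar> > \<delta>}) \<longlongrightarrow> 0) (at_top_in I)"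
proof -
  define A where "A n a = {\<omega> \<in> space (P n). \<bar>type_freq \<tau> n (X n \<omega>) a - measure \<mu> {x. \<tau> x = a}\<bar> > \<delta>}"
    for n a
  have "((\<lambda>n. measure (P n) (A n a)) \<longlongrightarrow> 0) (at_top_in I)" for a
    using vertices_tendsto[OF cont[of a]] \<delta> by (simp add: tendsto_in_prob_def A_def type_freq_def)
  then have lim: "((\<lambda>n. \<Sum>a\<in>range \<tau>. measure (P n) (A n a)) \<longlongrightarrow> 0) (at_top_in I)"
    by (intro tendsto_null_sum)
  show ?thesis
  proof (rule tendsto_sandwich[OF _ _ tendsto_const lim])
    show "eventually (\<lambda>n. measure (P n) {\<omega> \<in> space (P n). \<exists>a\<in>range \<tau>.
        \<bar>type_freq \<tau> n (X n \<omega>) a - measure \<mu> {x. \<tau> x = a}\<bar> > \<delta>} \<le> (\<Sum>a\<in>range \<tau>. measure (P n) (A n a)))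
        (at_top_in I)"
      using eventually_index
    proof eventually_elim
      case (elim n)
      then interpret prob_space "P n" by (rule prob_space_P)
      have "A n a \<in> sets (P n)" for a
        using type_freq_measurable[OF elim cont] unfolding A_def by measurable
      then have "measure (P n) (\<Union>a\<in>range \<tau>. A n a) \<le> (\<Sum>a\<in>range \<tau>. measure (P n) (A n a))"
        using fin by (intro finite_measure_subadditive_finite) auto
      also have "(\<Union>a\<in>range \<tau>. A n a) = {\<omega> \<in> space (P n). \<exists>a\<in>range \<tau>.
          \<bar>type_freq \<tau> n (X n \<omega>) a - measure \<mu> {x. \<tau> x = a}\<bar> > \<delta>}"
        by (auto simp: A_def)
      finally show ?case .
    qed
  qed simp
qed

lemma kernel_lambda_nonneg: "is_kernel \<kappa> \<Longrightarrow> 0 \<le> kernel_lambda \<mu> \<kappa> x"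
  unfolding kernel_lambda_def by (intro Bochner_Integration.integral_nonneg) (simp add: is_kernel_def)

text \<open>For all large \<open>n\<close> the deviation probability is at most \<open>B n\<close>,
  the integral of a bound \<open>bnd n\<close> valid given the points; the step minorant is chosen
  so fine that the limit of \<open>B\<close> is below the prescribed \<open>\<rho>\<close>.\<close>

lemma num_degree_tendsto:
  assumes g: "graphical \<mu> I P X \<kappa>s \<kappa>"
  shows "tendsto_in_prob (\<lambda>n. random_graph P X n (\<kappa>s n)) (\<lambda>n g. real (num_degree k g) / n)
    (\<integral>x. poisson_weight k (kernel_lambda \<mu> \<kappa> x) \<partial>\<mu>) (at_top_in I)"
  unfolding tendsto_in_prob_def
proof (intro allI impI tendstoI)
  fix \<epsilon> \<rho> :: real assume \<epsilon>: "0 < \<epsilon>" and \<rho>: "0 < \<rho>"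
  let ?F = "at_top_in I"
  define c0 where "c0 = (\<integral>x. poisson_weight k (kernel_lambda \<mu> \<kappa> x) \<partial>\<mu>)"
  define J where "J = (\<integral>p. case_prod \<kappa> p \<partial>(\<mu> \<Otimes>\<^sub>M \<mu>))"
  \<comment> \<open>Four parts are for the distance of the conditional mean from \<open>c0\<close>,
    one for the fluctuation about the conditional mean.\<close>
  define \<eta> where "\<eta> = \<epsilon> / 5"
  have \<eta>: "0 < \<eta>" using \<epsilon> by (simp add: \<eta>_def)
  \<comment> \<open>The first bound makes the errors from \<open>\<Phi>\<close> small against
    \<open>\<eta>\<close>; the second makes the limit of \<open>B\<close> at most
    \<open>6 * e / \<eta> \<le> \<rho> / 2\<close>.\<close>
  define e where "e = min (\<eta> / 4) (\<rho> * \<eta> / 12)"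
  have e: "0 < e" "e \<le> \<eta> / 4" "e \<le> \<rho> * \<eta> / 12"
    unfolding e_def using \<eta> \<rho>
    by (auto simp only: min_less_iff_conj intro: min.cobounded1 min.cobounded2) auto
  have ker: "is_kernel (\<kappa>s n)" if "n \<in> I" for n using g that by (simp add: graphical_def)
  have \<kappa>: "is_kernel \<kappa>" "integrable (\<mu> \<Otimes>\<^sub>M \<mu>) (case_prod \<kappa>)" using g by (auto simp: graphical_def)
  obtain \<tau> :: "'a \<Rightarrow> nat set" and c :: "nat set \<Rightarrow> nat set \<Rightarrow> real" and m :: nat where
    fin: "finite (range \<tau>)" and cont: "\<And>a. continuity_set \<mu> {x. \<tau> x = a}" and
    c: "\<And>a b. 0 \<le> c a b" "\<And>a b. c a b \<le> real m" and
    c\<kappa>s: "\<And>n x y. n \<in> I \<Longrightarrow> real m \<le> n \<Longrightarrow> c (\<tau> x) (\<tau> y) \<le> \<kappa>s n x y" and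
    c\<kappa>: "AE (x, y) in \<mu> \<Otimes>\<^sub>M \<mu>. c (\<tau> x) (\<tau> y) \<le> \<kappa> x y" and
    gap: "J - (\<integral>(x, y). c (\<tau> x) (\<tau> y) \<partial>(\<mu> \<Otimes>\<^sub>M \<mu>)) < e"
    using ex_step_minorant[OF g e(1)] unfolding J_def by blast
  have sets: "{x. \<tau> x = a} \<in> sets \<mu>" for a
    using cont[of a] by (simp add: continuity_set_def sets_mu)

  \<comment> \<open>For type proportions \<open>w\<close>, \<open>r w a\<close> is the mean degree
    of a vertex of type \<open>a\<close> under the step kernel, \<open>\<Phi> w\<close> the
    resulting mixed Poisson weight, \<open>\<Psi> w\<close> the double integral of the step kernel
    and \<open>V w\<close> the total mass. At \<open>w = u\<close> these are integrals over
    \<open>\<mu>\<close>.\<close>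
  define u where "u a = measure \<mu> {x. \<tau> x = a}" for a
  define r where "r w a = (\<Sum>b\<in>range \<tau>. c a b * w b)" for w and a
  define \<Phi> where "\<Phi> w = (\<Sum>a\<in>range \<tau>. poisson_weight k (r w a) * w a)" for w
  define \<Psi> where "\<Psi> w = (\<Sum>a\<in>range \<tau>. r w a * w a)" for w
  define V where "V w = (\<Sum>a\<in>range \<tau>. w a)" for w :: "nat set \<Rightarrow> real"

  \<comment> \<open>The step kernel against the limit kernel\<close>
  have int_r: "(\<integral>y. c (\<tau> x) (\<tau> y) \<partial>\<mu>) = r u (\<tau> x)" for x
    by (simp add: integral_step_function(1)[OF fin sets] r_def u_def)
  interpret pair_sigma_finite \<mu> \<mu> by unfold_locales
  have intK: "integrable (\<mu> \<Otimes>\<^sub>M \<mu>) (\<lambda>(x, y). c (\<tau> x) (\<tau> y))"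
  proof (rule Bochner_Integration.integrable_bound[OF \<kappa>(2)])
    show "(\<lambda>(x, y). c (\<tau> x) (\<tau> y)) \<in> borel_measurable (\<mu> \<Otimes>\<^sub>M \<mu>)"
      by (rule measurable_step_function[OF fin sets])
    show "AE p in \<mu> \<Otimes>\<^sub>M \<mu>. norm (case p of (x, y) \<Rightarrow> c (\<tau> x) (\<tau> y)) \<le> norm (case_prod \<kappa> p)"
      using c\<kappa> by eventually_elim (auto simp: c(1) abs_of_nonneg)
  qed
  have \<Psi>u: "(\<integral>(x, y). c (\<tau> x) (\<tau> y) \<partial>(\<mu> \<Otimes>\<^sub>M \<mu>)) = \<Psi> u"
    using integral_fst'[OF intK]
    by (simp add: int_r integral_step_function(1)[OF fin sets] \<Psi>_def u_def[symmetric])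
  have "\<bar>(\<integral>x. poisson_weight k (r u (\<tau> x)) \<partial>\<mu>) - c0\<bar> \<le> J - \<Psi> u"
    using poisson_mixture_diff_le[OF finite_measure_axioms intK \<kappa>(2), of k] c\<kappa> c(1) \<kappa>(1)
    by (auto simp: int_r c0_def J_def \<Psi>u[symmetric] kernel_lambda_def is_kernel_def case_prod_unfold)
  then have \<Phi>u: "\<bar>\<Phi> u - c0\<bar> < e"
    using gap \<Psi>u by (simp add: integral_step_function(1)[OF fin sets, of "\<lambda>a. poisson_weight k (r u a)"]
        \<Phi>_def u_def[symmetric])

  \<comment> \<open>Continuity in the type proportions and the exceptional event\<close>
  have r_lim: "(\<lambda>j. r (U j) a) \<longlonglongrightarrow> r w a" if "\<And>b. b \<in> range \<tau> \<Longrightarrow> (\<lambda>j. U j b) \<longlonglongrightarrow> w b"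
    for U :: "nat \<Rightarrow> nat set \<Rightarrow> real" and w a
    unfolding r_def by (intro tendsto_intros that)
  have pw_cont: "isCont (poisson_weight k) t" for t
    by (rule DERIV_isCont[OF poisson_weight_has_derivative])
  obtain d1 where d1: "0 < d1" "\<And>w. (\<forall>a\<in>range \<tau>. \<bar>w a - u a\<bar> \<le> d1) \<Longrightarrow> \<bar>\<Phi> w - \<Phi> u\<bar> < e"
  proof -
    have "(\<lambda>j. \<Phi> (U j)) \<longlonglongrightarrow> \<Phi> u" if "\<And>a. a \<in> range \<tau> \<Longrightarrow> (\<lambda>j. U j a) \<longlonglongrightarrow> u a" for U
      unfolding \<Phi>_def by (intro tendsto_sum tendsto_mult isCont_tendsto_compose[OF pw_cont] r_lim that)
    from finite_coordinates_eps_delta[of "range \<tau>" u \<Phi>, OF this e(1)] that show thesis by blast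
  qed
  obtain d2 where d2: "0 < d2" "\<And>w. (\<forall>a\<in>range \<tau>. \<bar>w a - u a\<bar> \<le> d2) \<Longrightarrow> \<bar>\<Psi> w - \<Psi> u\<bar> < e"
  proof -
    have "(\<lambda>j. \<Psi> (U j)) \<longlonglongrightarrow> \<Psi> u" if "\<And>a. a \<in> range \<tau> \<Longrightarrow> (\<lambda>j. U j a) \<longlonglongrightarrow> u a" for U
      unfolding \<Psi>_def by (intro tendsto_sum tendsto_mult r_lim that)
    from finite_coordinates_eps_delta[of "range \<tau>" u \<Psi>, OF this e(1)] that show thesis by blast
  qed
  obtain d3 where d3: "0 < d3" "\<And>w. (\<forall>a\<in>range \<tau>. \<bar>w a - u a\<bar> \<le> d3) \<Longrightarrow> \<bar>V w - V u\<bar> < 1"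
  proof -
    have "(\<lambda>j. V (U j)) \<longlonglongrightarrow> V u" if "\<And>a. a \<in> range \<tau> \<Longrightarrow> (\<lambda>j. U j a) \<longlonglongrightarrow> u a" for U
      unfolding V_def by (intro tendsto_sum that)
    from finite_coordinates_eps_delta[of "range \<tau>" u V, OF this zero_less_one] that show thesis by blast
  qed
  define d where "d = min d1 (min d2 d3)"
  have d: "0 < d" using d1 d2 d3 by (simp add: d_def)
  \<comment> \<open>Off \<open>H n\<close> the number of vertices divided by \<open>n\<close> is
    below \<open>M\<close>.\<close>
  define M where "M = V u + 1"
  define S where "S n \<omega> = scaled_degree_sum n (\<kappa>s n) (X n \<omega>)" for n \<omega>
  define U where "U n \<omega> = type_freq \<tau> n (X n \<omega>)" for n \<omega>
  define H where "H n = {\<omega> \<in> space (P n). \<exists>a\<in>range \<tau>. \<bar>U n \<omega> a - u a\<bar> > d}" for n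
  have H_lim: "((\<lambda>n. measure (P n) (H n)) \<longlongrightarrow> 0) ?F"
    using type_freqs_deviate_tendsto_0[OF fin cont d] by (simp add: H_def U_def u_def)
  \<comment> \<open>The summand \<open>e\<close> absorbs the fluctuation of \<open>\<Psi>\<close>,
    and the last summand the diagonal terms.\<close>
  define s where "s n = e - \<Psi> u + real m * M / n" for n
  text \<open>Off the exceptional event \<open>H n\<close>, \<open>W n\<close> dominates the total discrepancy between the edge
    probabilities and the step minorant. On \<open>H n\<close> the shift by \<open>s n\<close>, which may be negative, is
    dropped, so that \<open>W n\<close> is nonnegative everywhere.\<close>
  define W where "W n \<omega> = S n \<omega> + s n * indicator (space (P n) - H n) \<omega>" for n \<omega>
  \<comment> \<open>The terms cover, in turn, atypical points, a large replacement error, a large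
    second-order part of Le Cam's error, and Chebyshev's bound at distance
    \<open>n * \<eta>\<close>.\<close>
  define bnd where "bnd n \<omega> = indicator (H n) \<omega> + 3 / \<eta> * W n \<omega> +
      (2 * real m / (n * \<eta>) + 2 / (n * \<eta>\<^sup>2)) * S n \<omega>" for n \<omega>
  define B where "B n = measure (P n) (H n) + 3 / \<eta> * ((\<integral>\<omega>. S n \<omega> \<partial>P n) + s n * (1 - measure (P n) (H n))) +
      (2 * real m / \<eta> / n + 2 / \<eta>\<^sup>2 / n) * (\<integral>\<omega>. S n \<omega> \<partial>P n)" for n

  \<comment> \<open>The deviation probability at a fixed large index\<close>
  have bound: "measure (random_graph P X n (\<kappa>s n)) {g \<in> space (random_graph P X n (\<kappa>s n)).
      \<epsilon> < \<bar>real (num_degree k g) / n - c0\<bar>} \<le> B n"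
    if n: "n \<in> I" "max 1 (max (real m) (4 * real m * M / \<eta>)) \<le> n" and int: "integrable (P n) (S n)" for n
  proof -
    interpret Pn: prob_space "P n" by (rule prob_space_P[OF n(1)])
    \<comment> \<open>The last requirement makes the four diagonal terms cost at most one
      \<open>\<eta>\<close>.\<close>
    have n0: "0 < n" and mn: "real m \<le> n" and Mn: "4 * (real m * M / n) \<le> \<eta>"
      using n(2) \<eta> by (auto simp: field_simps)
    have Hm: "H n \<in> sets (P n)"
      using type_freq_measurable[OF n(1) cont] fin unfolding H_def U_def by measurable
    have S0: "0 \<le> S n \<omega>" for \<omega>
      unfolding S_def by (rule scaled_degree_sum_nonneg[OF ker[OF n(1)] n0])
    have key: "measure (graph_given n (\<kappa>s n) (X n \<omega>)) {g. \<epsilon> < \<bar>real (num_degree k g) / n - c0\<bar>} \<le> bnd n \<omega>"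
      if \<omega>: "\<omega> \<in> space (P n)" for \<omega>
    proof (cases "\<omega> \<in> H n")
      case True
      have "measure (graph_given n (\<kappa>s n) (X n \<omega>)) {g. \<epsilon> < \<bar>real (num_degree k g) / n - c0\<bar>} \<le> 1"
        by (rule measure_pmf.prob_le_1)
      also have "\<dots> \<le> bnd n \<omega>"
        using True S0[of \<omega>] n0 \<eta> by (simp add: bnd_def W_def)
      finally show ?thesis .
    next
      case False
      define xs where "xs = X n \<omega>"
      let ?L = "\<lambda>i j. c (\<tau> (xs ! i)) (\<tau> (xs ! j))"
      let ?E = "measure_pmf.expectation (graph_given n (\<kappa>s n) xs) (\<lambda>g. real (num_degree k g))"
      have close: "\<forall>a\<in>range \<tau>. \<bar>U n \<omega> a - u a\<bar> \<le> d"
        using False \<omega> by (auto simp: H_def not_less)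
      have rL: "(\<Sum>j<length xs. ?L i j) / n = r (U n \<omega>) (\<tau> (xs ! i))" for i
        using sum_type_freq[OF fin, of "c (\<tau> (xs ! i))"] by (simp add: r_def U_def xs_def)
      have \<Phi>U: "(\<Sum>i<length xs. poisson_weight k ((\<Sum>j<length xs. ?L i j) / n)) / n = \<Phi> (U n \<omega>)"
        unfolding rL using sum_type_freq[OF fin, of "\<lambda>a. poisson_weight k (r (U n \<omega>) a)" xs n]
        by (simp add: \<Phi>_def U_def xs_def)
      have "(\<Sum>i<length xs. \<Sum>j<length xs. ?L i j) / n\<^sup>2 = (\<Sum>i<length xs. (\<Sum>j<length xs. ?L i j) / n) / n"
        by (simp add: power2_eq_square sum_divide_distrib)
      also have "\<dots> = \<Psi> (U n \<omega>)"
        unfolding rL using sum_type_freq[OF fin, of "r (U n \<omega>)" xs n]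
        by (simp add: \<Psi>_def U_def xs_def)
      finally have \<Psi>U: "(\<Sum>i<length xs. \<Sum>j<length xs. ?L i j) / n\<^sup>2 = \<Psi> (U n \<omega>)" .
      have VU: "real (length xs) / n = V (U n \<omega>)"
        using sum_type_freq[OF fin, of "\<lambda>_. 1" xs n] by (simp add: V_def U_def xs_def)
      have small: "\<bar>\<Phi> (U n \<omega>) - \<Phi> u\<bar> < e" "\<bar>\<Psi> (U n \<omega>) - \<Psi> u\<bar> < e" "\<bar>V (U n \<omega>) - V u\<bar> < 1"
        using close by (auto intro!: d1 d2 d3 simp: d_def)
      have "real m * (real (length xs) / n) / n \<le> real m * M / n"
        using small(3) VU n0 by (intro divide_right_mono mult_left_mono) (auto simp: M_def)
      then have diag: "real m * real (length xs) / n\<^sup>2 \<le> real m * M / n"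
        by (simp add: power2_eq_square)
      have W: "W n \<omega> = S n \<omega> + s n" using False \<omega> by (simp add: W_def)
      note appr = expectation_num_degree_minorant(1)[where L = ?L and xs = xs and m = "real m",
          OF ker[OF n(1)] n0 of_nat_0_le_iff mn c c\<kappa>s[OF n(1) mn], unfolded \<Psi>U]
        expectation_num_degree_minorant(2)[where L = ?L and xs = xs and k = k and m = "real m",
          OF ker[OF n(1)] n0 of_nat_0_le_iff mn c c\<kappa>s[OF n(1) mn], unfolded \<Phi>U \<Psi>U]
      have S: "scaled_degree_sum n (\<kappa>s n) xs = S n \<omega>" by (simp add: S_def xs_def)
      have W0: "0 \<le> W n \<omega>"
        using appr(1) diag small(2) unfolding S W s_def by linarith
      have EW: "\<bar>?E / n - \<Phi> (U n \<omega>)\<bar> \<le> 3 * W n \<omega> + 2 * (real m / n) * S n \<omega> + \<eta>"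
        using appr(2) diag small(2) Mn e(1) unfolding S W s_def
      proof -
        assume a: "\<bar>?E / n - \<Phi> (U n \<omega>)\<bar> \<le> 3 * (S n \<omega> - \<Psi> (U n \<omega>)) +
          2 * (real m / n) * S n \<omega> + 4 * (real m * real (length xs) / n\<^sup>2)"
        have "3 * (S n \<omega> - \<Psi> (U n \<omega>)) \<le> 3 * (S n \<omega> + (e - \<Psi> u + real m * M / n))"
          using small(2) W0 diag order_trans[OF _ diag, of 0] by auto
        then show "\<bar>?E / n - \<Phi> (U n \<omega>)\<bar> \<le> 3 * (S n \<omega> + (e - \<Psi> u + real m * M / n)) +
            2 * (real m / n) * S n \<omega> + \<eta>"
          using a diag Mn by linarith
      qed
      have T0: "0 \<le> 2 * real m / (n * \<eta>) * S n \<omega>" "0 \<le> 2 / (n * \<eta>\<^sup>2) * S n \<omega>" "0 \<le> 3 / \<eta> * W n \<omega>"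
        using S0[of \<omega>] W0 n0 \<eta> by auto
      have bnd: "bnd n \<omega> = 3 / \<eta> * W n \<omega> + 2 * real m / (n * \<eta>) * S n \<omega> + 2 / (n * \<eta>\<^sup>2) * S n \<omega>"
        using False by (simp add: bnd_def algebra_simps)
      show ?thesis
      \<comment> \<open>Markov's inequality in pointwise form: if one of the terms reaches 1, the
        bound is trivial; otherwise both errors are below \<open>\<eta>\<close>.\<close>
      proof (cases "1 \<le> 3 / \<eta> * W n \<omega> \<or> 1 \<le> 2 * real m / (n * \<eta>) * S n \<omega>")
        case True
        then have "1 \<le> bnd n \<omega>" unfolding bnd using T0 by linarith
        then show ?thesis using measure_pmf.prob_le_1 order_trans by blast
      next
        case False
        then have "3 * W n \<omega> < \<eta>" "2 * (real m / n) * S n \<omega> < \<eta>"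
          using \<eta> n0 by (auto simp: field_simps)
        then have "\<bar>?E / n - c0\<bar> \<le> 4 * \<eta>"
          using EW small(1) \<Phi>u e(2) \<eta> by linarith
        then have "{g. \<epsilon> < \<bar>real (num_degree k g) / n - c0\<bar>} \<subseteq> {g. n * \<eta> \<le> \<bar>real (num_degree k g) - ?E\<bar>}"
        proof (intro subsetI, unfold mem_Collect_eq)
          fix g assume E: "\<bar>?E / n - c0\<bar> \<le> 4 * \<eta>" and g: "\<epsilon> < \<bar>real (num_degree k g) / n - c0\<bar>"
          have "\<eta> \<le> \<bar>z - y\<bar>" if "\<bar>y - c0\<bar> \<le> 4 * \<eta>" "5 * \<eta> < \<bar>z - c0\<bar>" for y z :: real
            using that by linarith
          from this[OF E] g have "\<eta> \<le> \<bar>real (num_degree k g) / n - ?E / n\<bar>" by (simp add: \<eta>_def)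
          also have "\<dots> = \<bar>real (num_degree k g) - ?E\<bar> / n"
            using n0 by (simp add: abs_divide flip: diff_divide_distrib)
          finally show "n * \<eta> \<le> \<bar>real (num_degree k g) - ?E\<bar>"
            using n0 by (simp add: field_simps)
        qed
        then have "measure (graph_given n (\<kappa>s n) xs) {g. \<epsilon> < \<bar>real (num_degree k g) / n - c0\<bar>} \<le>
            measure (graph_given n (\<kappa>s n) xs) {g. n * \<eta> \<le> \<bar>real (num_degree k g) - ?E\<bar>}"
          by (intro measure_pmf.finite_measure_mono) auto
        also have "\<dots> \<le> 2 * n * scaled_degree_sum n (\<kappa>s n) xs / (n * \<eta>)\<^sup>2"
          using n0 \<eta> by (intro num_degree_concentration ker n) auto
        also have "\<dots> = 2 / (n * \<eta>\<^sup>2) * S n \<omega>"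
          using n0 \<eta> by (simp add: S field_simps power2_eq_square)
        also have "\<dots> \<le> bnd n \<omega>" unfolding bnd using T0 by linarith
        finally show ?thesis by (simp add: xs_def)
      qed
    qed
    have intI: "integrable (P n) (indicator A :: _ \<Rightarrow> real)" if "A \<in> sets (P n)" for A
      using that by (intro integrable_real_indicator) (auto simp: Pn.emeasure_eq_measure)
    have Gm: "space (P n) - H n \<in> sets (P n)" using Hm by auto
    have intb: "integrable (P n) (bnd n)"
      unfolding bnd_def W_def using Hm Gm
      by (intro Bochner_Integration.integrable_add integrable_mult_right intI int)
    have "measure (random_graph P X n (\<kappa>s n)) {g \<in> space (random_graph P X n (\<kappa>s n)).
        \<epsilon> < \<bar>real (num_degree k g) / n - c0\<bar>} \<le> integral\<^sup>L (P n) (bnd n)"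
      using key by (intro measure_random_graph_le[OF n(1) ker[OF n(1)] intb])
        (simp add: space_random_graph[OF n(1) ker[OF n(1)]])
    also have "\<dots> = B n"
      unfolding bnd_def W_def B_def using Hm Gm
      by (simp add: int intI Pn.prob_compl Bochner_Integration.integral_add
          sets.sets_into_space Int_absorb2 mult.commute)
    finally show ?thesis .
  qed

  \<comment> \<open>The limit of the bound\<close>
  have SE: "eventually (\<lambda>n. integrable (P n) (S n)) ?F" "((\<lambda>n. \<integral>\<omega>. S n \<omega> \<partial>P n) \<longlongrightarrow> J) ?F"
    using expected_degree_sum_tendsto[OF g] by (auto simp: S_def[abs_def] J_def)
  have s_lim: "(s \<longlongrightarrow> e - \<Psi> u + 0) ?F"
    unfolding s_def[abs_def] by (intro tendsto_add tendsto_const tendsto_const_div_at_top_in)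
  \<comment> \<open>The limit is left unsimplified so that the limit rules match it. What survives
    is \<open>3 / \<eta> * (J + (e - \<Psi> u))\<close>, where \<open>J - \<Psi> u < e\<close> by
    the choice of the minorant.\<close>
  have B_lim: "(B \<longlongrightarrow> 0 + 3 / \<eta> * (J + (e - \<Psi> u + 0) * (1 - 0)) + (0 + 0) * J) ?F"
    unfolding B_def[abs_def]
    by (intro tendsto_add tendsto_mult tendsto_diff tendsto_const H_lim SE(2) s_lim
        tendsto_const_div_at_top_in)
  have "3 / \<eta> * (J + (e - \<Psi> u)) < \<rho>"
  proof -
    have "3 / \<eta> * (J + (e - \<Psi> u)) \<le> 3 / \<eta> * (2 * e)"
      using gap \<Psi>u \<eta> by (intro mult_left_mono) auto
    also have "\<dots> \<le> 3 / \<eta> * (2 * (\<rho> * \<eta> / 12))"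
      using e(3) \<eta> by (intro mult_left_mono) auto
    also have "\<dots> = \<rho> / 2" using \<eta> by simp
    finally show ?thesis using \<rho> by linarith
  qed
  then have "eventually (\<lambda>n. B n < \<rho>) ?F"
    by (intro order_tendstoD(2)[OF B_lim]) simp
  then have "eventually (\<lambda>n. measure (random_graph P X n (\<kappa>s n)) {g \<in> space (random_graph P X n (\<kappa>s n)).
      \<epsilon> < \<bar>real (num_degree k g) / n - c0\<bar>} < \<rho>) ?F"
    using SE(1) eventually_at_top_in_ge[of I "max 1 (max (real m) (4 * real m * M / \<eta>))"]
    by eventually_elim (use bound in \<open>meson order_le_less_trans\<close>)
  then show "eventually (\<lambda>n. dist (measure (random_graph P X n (\<kappa>s n)) {g \<in> space (random_graph P X n (\<kappa>s n)).
      \<epsilon> < \<bar>real (num_degree k g) / n - (\<integral>x. poisson_weight k (kernel_lambda \<mu> \<kappa> x) \<partial>\<mu>)\<bar>}) 0 < \<rho>) ?F"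
    by (simp add: c0_def)
qed

text \<open>Given the points, the number of vertices is deterministic, so the conditional
  probability is an indicator; the whole space is a continuity set.\<close>

lemma card_verts_tendsto:
  assumes ker: "\<And>n. n \<in> I \<Longrightarrow> is_kernel (\<kappa>s n)"
  shows "tendsto_in_prob (\<lambda>n. random_graph P X n (\<kappa>s n)) (\<lambda>n g. real (card (verts g)) / n)
    (measure \<mu> UNIV) (at_top_in I)"
  unfolding tendsto_in_prob_def
proof (intro allI impI)
  fix \<epsilon> :: real assume \<epsilon>: "0 < \<epsilon>"
  define A where "A n = {\<omega> \<in> space (P n). \<epsilon> < \<bar>real (length (X n \<omega>)) / n - measure \<mu> UNIV\<bar>}" for n
  have lim: "((\<lambda>n. measure (P n) (A n)) \<longlongrightarrow> 0) (at_top_in I)"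
    using vertices_tendsto[OF continuity_set_UNIV] \<epsilon>
    by (simp add: tendsto_in_prob_def A_def)
  show "((\<lambda>n. measure (random_graph P X n (\<kappa>s n)) {g \<in> space (random_graph P X n (\<kappa>s n)).
      \<epsilon> < \<bar>real (card (verts g)) / n - measure \<mu> UNIV\<bar>}) \<longlongrightarrow> 0) (at_top_in I)"
  proof (rule tendsto_sandwich[OF _ _ tendsto_const lim])
    show "eventually (\<lambda>n. measure (random_graph P X n (\<kappa>s n)) {g \<in> space (random_graph P X n (\<kappa>s n)).
        \<epsilon> < \<bar>real (card (verts g)) / n - measure \<mu> UNIV\<bar>} \<le> measure (P n) (A n)) (at_top_in I)"
      using eventually_index
    proof eventually_elim
      case (elim n)
      interpret prob_space "P n" by (rule prob_space_P[OF elim])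
      have "(\<lambda>\<omega>. real (length (X n \<omega>))) \<in> borel_measurable (P n)"
        using random_list_count_measurable[OF random_list_X[OF elim], of UNIV] by simp
      then have A: "A n \<in> sets (P n)" unfolding A_def by measurable
      have "measure (graph_given n (\<kappa>s n) (X n \<omega>)) {g. \<epsilon> < \<bar>real (card (verts g)) / n - measure \<mu> UNIV\<bar>} \<le>
          indicator (A n) \<omega>" if "\<omega> \<in> space (P n)" for \<omega>
      proof -
        have "card (verts (graph_of_indicator v b)) = v" for v b
          by (simp add: verts_def graph_of_indicator_def)
        then show ?thesis
          using that by (auto simp: graph_given_eq_map A_def indicator_def vimage_def)
      qed
      moreover have "integrable (P n) (indicator (A n) :: _ \<Rightarrow> real)"
        using A by (intro integrable_real_indicator) (auto simp: emeasure_eq_measure)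
      ultimately have "measure (random_graph P X n (\<kappa>s n)) {g. \<epsilon> < \<bar>real (card (verts g)) / n - measure \<mu> UNIV\<bar>} \<le>
          integral\<^sup>L (P n) (indicator (A n))"
        by (intro measure_random_graph_le[OF elim ker[OF elim]])
      also have "\<dots> = measure (P n) (A n)"
        using sets.sets_into_space[OF A] by (simp add: Int_absorb2)
      finally show ?case by (simp add: space_random_graph[OF elim ker[OF elim]])
    qed
  qed simp
qed

end

section \<open>The mixed Poisson law\<close>

lemma pmf_Po: "0 \<le> r \<Longrightarrow> pmf (Po r) k = poisson_weight k r"
  by (cases "r = 0") (auto simp: Po_def poisson_weight_zero, simp add: poisson_weight_def)

lemma Po_measurable:
  assumes f: "f \<in> borel_measurable M" and f0: "\<And>x. 0 \<le> f x"
  shows "(\<lambda>x. measure_pmf (Po (f x))) \<in> measurable M (subprob_algebra (count_space UNIV))"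
proof (rule measurable_subprob_algebra)
  fix A :: "nat set"
  have "emeasure (measure_pmf (Po (f x))) A = (\<Sum>j. ennreal (poisson_weight j (f x)) * indicator A j)" for x
  proof -
    have "emeasure (measure_pmf (Po (f x))) A = (\<integral>\<^sup>+ j. indicator A j \<partial>measure_pmf (Po (f x)))"
      by simp
    also have "\<dots> = (\<integral>\<^sup>+ j. ennreal (pmf (Po (f x)) j) * indicator A j \<partial>count_space UNIV)"
      by (rule nn_integral_measure_pmf)
    also have "\<dots> = (\<Sum>j. ennreal (poisson_weight j (f x)) * indicator A j)"
      by (simp add: nn_integral_count_space_nat pmf_Po f0)
    finally show ?thesis .
  qed
  moreover have "(\<lambda>x. \<Sum>j. ennreal (poisson_weight j (f x)) * indicator A j) \<in> borel_measurable M"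
    using f by measurable
  ultimately show "(\<lambda>x. emeasure (measure_pmf (Po (f x))) A) \<in> borel_measurable M"
    by simp
qed (auto simp: measure_pmf.subprob_space_axioms)

lemma measure_mixed_poisson:
  assumes fin: "finite_measure M" and pos: "0 < measure M (space M)"
    and f: "f \<in> borel_measurable M" and f0: "\<And>x. 0 \<le> f x"
  shows "measure (mixed_poisson M f) {k} = (\<integral>x. poisson_weight k (f x) \<partial>M) / measure M (space M)"
proof -
  interpret finite_measure M by fact
  have ne: "space M \<noteq> {}" using pos by auto
  have int: "integrable M (\<lambda>x. poisson_weight k (f x))" by (rule integrable_poisson_weight[OF f f0])
  have "emeasure (M \<bind> (\<lambda>x. measure_pmf (Po (f x)))) {k} = (\<integral>\<^sup>+ x. emeasure (measure_pmf (Po (f x))) {k} \<partial>M)"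
    by (rule emeasure_bind[OF ne Po_measurable[OF f f0]]) simp
  also have "\<dots> = (\<integral>\<^sup>+ x. ennreal (poisson_weight k (f x)) \<partial>M)"
    by (simp add: emeasure_pmf_single pmf_Po f0)
  also have "\<dots> = ennreal (\<integral>x. poisson_weight k (f x) \<partial>M)"
    using int by (intro nn_integral_eq_integral) (auto simp: poisson_weight_nonneg f0)
  finally have e: "emeasure (M \<bind> (\<lambda>x. measure_pmf (Po (f x)))) {k} =
      ennreal (\<integral>x. poisson_weight k (f x) \<partial>M)" .
  have "0 \<le> (\<integral>x. poisson_weight k (f x) \<partial>M)"
    by (intro Bochner_Integration.integral_nonneg poisson_weight_nonneg f0)
  moreover have "1 / emeasure M (space M) = ennreal (1 / measure M (space M))"
    using pos divide_ennreal[of 1 "measure M (space M)"] by (simp add: emeasure_eq_measure)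
  ultimately have "enn2real (1 / emeasure M (space M) * ennreal (\<integral>x. poisson_weight k (f x) \<partial>M)) =
      (\<integral>x. poisson_weight k (f x) \<partial>M) / measure M (space M)"
    by (simp add: enn2real_mult)
  then show ?thesis
    by (simp add: measure_def mixed_poisson_def e)
qed

theorem theorem3p13:
  fixes \<mu> :: "'a::{metric_space, second_countable_topology} measure"
    and I :: "real set"
    and P :: "real \<Rightarrow> 'w measure"
    and X :: "real \<Rightarrow> 'w \<Rightarrow> 'a list"
    and \<kappa>s :: "real \<Rightarrow> 'a \<Rightarrow> 'a \<Rightarrow> real"
    and \<kappa> :: "'a \<Rightarrow> 'a \<Rightarrow> real"
    and k :: nat
  assumes "generalized_vertex_space \<mu> I P X"
    and "graphical \<mu> I P X \<kappa>s \<kappa>"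
  shows "tendsto_in_prob (\<lambda>n. random_graph P X n (\<kappa>s n))
           (\<lambda>n g. real (num_degree k g) / n)
           (\<integral>x. kernel_lambda \<mu> \<kappa> x ^ k / fact k * exp (- kernel_lambda \<mu> \<kappa> x) \<partial>\<mu>)
           (at_top_in I) \<and>
         tendsto_in_prob (\<lambda>n. random_graph P X n (\<kappa>s n))
           (\<lambda>n g. real (num_degree k g) / real (card (verts g)))
           (measure (mixed_poisson \<mu> (kernel_lambda \<mu> \<kappa>)) {k})
           (at_top_in I)"
proof -
  interpret generalized_vertex_space \<mu> I P X by fact
  let ?Q = "\<lambda>n. random_graph P X n (\<kappa>s n)"
  define c where "c = (\<integral>x. poisson_weight k (kernel_lambda \<mu> \<kappa> x) \<partial>\<mu>)"
  have ker: "is_kernel (\<kappa>s n)" if "n \<in> I" for n using assms(2) that by (simp add: graphical_def)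
  have \<kappa>: "is_kernel \<kappa>" "integrable (\<mu> \<Otimes>\<^sub>M \<mu>) (case_prod \<kappa>)"
    using assms(2) by (auto simp: graphical_def)
  interpret pair_sigma_finite \<mu> \<mu> by unfold_locales
  have "(\<lambda>x. \<integral>y. case_prod \<kappa> (x, y) \<partial>\<mu>) \<in> borel_measurable \<mu>"
    by (rule borel_measurable_integrable[OF integrable_fst'[OF \<kappa>(2)]])
  then have meas: "kernel_lambda \<mu> \<kappa> \<in> borel_measurable \<mu>"
    by (simp add: kernel_lambda_def[abs_def])
  have Z: "tendsto_in_prob ?Q (\<lambda>n g. real (num_degree k g) / n) c (at_top_in I)"
    unfolding c_def by (rule num_degree_tendsto[OF assms(2)])
  have M: "0 < measure \<mu> UNIV"
    using mu_pos by (simp add: emeasure_eq_measure)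
  have c0: "0 \<le> c"
    unfolding c_def
    by (intro Bochner_Integration.integral_nonneg poisson_weight_nonneg kernel_lambda_nonneg \<kappa>)
  have Q: "eventually (\<lambda>n. finite_measure (?Q n) \<and> sets (?Q n) = UNIV) (at_top_in I)"
    using eventually_index
  proof eventually_elim
    case (elim n)
    note R = prob_space_random_graph[where P = P and X = X,
        OF prob_space_P[OF elim] random_list_X[OF elim] ker[OF elim] index_gt_0[OF elim]]
    show ?case using R(1,2) by (simp add: prob_space.finite_measure)
  qed
  have "tendsto_in_prob ?Q (\<lambda>n g. (real (num_degree k g) / n) / (real (card (verts g)) / n))
      (c / measure \<mu> UNIV) (at_top_in I)"
    by (rule tendsto_in_prob_divide[OF Q Z card_verts_tendsto[OF ker] c0 M])
  moreover have "measure (mixed_poisson \<mu> (kernel_lambda \<mu> \<kappa>)) {k} = c / measure \<mu> UNIV"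
    using measure_mixed_poisson[OF finite_measure_axioms _ meas kernel_lambda_nonneg[OF \<kappa>(1)], of k] M
    by (simp add: c_def)
  \<comment> \<open>The factor \<open>n\<close> cancels even for a graph without vertices, where
    both quotients are 0 because division by 0 gives 0.\<close>
  moreover have "eventually (\<lambda>n. (\<lambda>g. (real (num_degree k g) / n) / (real (card (verts g)) / n)) =
      (\<lambda>g. real (num_degree k g) / real (card (verts g)))) (at_top_in I)"
    using eventually_index by eventually_elim (auto dest: index_gt_0)
  ultimately show ?thesis
    using Z tendsto_in_prob_cong unfolding c_def poisson_weight_def by fastforce
qed

end
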